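(* Over $\mathsf{RCA}_0$, $\Sigma^0_2\text{-}\mathsf{IND}$ implies the Additive Ramsey Theorem.
   Context: $\mathsf{RCA}_0$: second-order arithmetic with $\Delta^0_1$-comprehension and $\Sigma^0_1$-induction. $\Sigma^0_2\text{-}\mathsf{IND}$: the induction scheme for $\Sigma^0_2$ formulae with parameters. Additive Ramsey Theorem: for every finite semigroup $(S,* )$ and every colouring $C:[\mathbb{N}]^2\to S$ of unordered pairs such that $C(i,j)*C(j,k)=C(i,k)$ for all $i<j<k$, there is an infinite set $I\subseteq\mathbb{N}$ and a colour $a\in S$ with $C(i,j)=a$ for all $i<j$ in $I$. *)

theory Defs
  imports Main
begin

text \<open>Number terms; number variables are de Bruijn indices.\<close>
datatype trm = Var nat | Zero | One | Add trm trm | Mul trm trm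

text \<open>Formulas. Number quantifiers (ExN/AllN, bounded BExN/BAllN) bind number
  variable 0; set quantifiers (ExS/AllS) bind set variable 0 (separate de Bruijn
  indexing for set variables). In BExN t p / BAllN t p the bound t is read in the
  outer context, so it cannot contain the bound variable.\<close>
datatype fm =
    Eq trm trm | Lt trm trm | Mem trm nat
  | Neg fm | Conj fm fm | Disj fm fm | Imp fm fm
  | ExN fm | AllN fm | BExN trm fm | BAllN trm fm
  | ExS fm | AllS fm

text \<open>L2-structures (Henkin semantics): first-order part is the whole type 'm,
  second-order part is a family of subsets s_sets.\<close>
record 'm l2struct =
  s_zero :: 'm
  s_one :: 'm
  s_add :: "'m \<Rightarrow> 'm \<Rightarrow> 'm"
  s_mul :: "'m \<Rightarrow> 'm \<Rightarrow> 'm"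
  s_less :: "'m \<Rightarrow> 'm \<Rightarrow> bool"
  s_sets :: "'m set set"

fun evalt :: "'m l2struct \<Rightarrow> (nat \<Rightarrow> 'm) \<Rightarrow> trm \<Rightarrow> 'm" where
  "evalt M e (Var i) = e i"
| "evalt M e Zero = s_zero M"
| "evalt M e One = s_one M"
| "evalt M e (Add s t) = s_add M (evalt M e s) (evalt M e t)"
| "evalt M e (Mul s t) = s_mul M (evalt M e s) (evalt M e t)"

fun sat :: "'m l2struct \<Rightarrow> (nat \<Rightarrow> 'm) \<Rightarrow> (nat \<Rightarrow> 'm set) \<Rightarrow> fm \<Rightarrow> bool" where
  "sat M e E (Eq s t) = (evalt M e s = evalt M e t)"
| "sat M e E (Lt s t) = s_less M (evalt M e s) (evalt M e t)"
| "sat M e E (Mem t k) = (evalt M e t \<in> E k)"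
| "sat M e E (Neg p) = (\<not> sat M e E p)"
| "sat M e E (Conj p q) = (sat M e E p \<and> sat M e E q)"
| "sat M e E (Disj p q) = (sat M e E p \<or> sat M e E q)"
| "sat M e E (Imp p q) = (sat M e E p \<longrightarrow> sat M e E q)"
| "sat M e E (ExN p) = (\<exists>x. sat M (case_nat x e) E p)"
| "sat M e E (AllN p) = (\<forall>x. sat M (case_nat x e) E p)"
| "sat M e E (BExN t p) = (\<exists>x. s_less M x (evalt M e t) \<and> sat M (case_nat x e) E p)"
| "sat M e E (BAllN t p) = (\<forall>x. s_less M x (evalt M e t) \<longrightarrow> sat M (case_nat x e) E p)"
| "sat M e E (ExS p) = (\<exists>X\<in>s_sets M. sat M e (case_nat X E) p)"
| "sat M e E (AllS p) = (\<forall>X\<in>s_sets M. sat M e (case_nat X E) p)"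

text \<open>Arithmetical hierarchy (as in Simpson, SOSOA, Sect. II.2 and I.2)\<close>
fun bounded :: "fm \<Rightarrow> bool" where
  "bounded (Eq s t) = True"
| "bounded (Lt s t) = True"
| "bounded (Mem t k) = True"
| "bounded (Neg p) = bounded p"
| "bounded (Conj p q) = (bounded p \<and> bounded q)"
| "bounded (Disj p q) = (bounded p \<and> bounded q)"
| "bounded (Imp p q) = (bounded p \<and> bounded q)"
| "bounded (BExN t p) = bounded p"
| "bounded (BAllN t p) = bounded p"
| "bounded (ExN p) = False"
| "bounded (AllN p) = False"
| "bounded (ExS p) = False"
| "bounded (AllS p) = False"

definition Sigma01 :: "fm \<Rightarrow> bool" where
  "Sigma01 p \<longleftrightarrow> (\<exists>q. p = ExN q \<and> bounded q)"

definition Pi01 :: "fm \<Rightarrow> bool" where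
  "Pi01 p \<longleftrightarrow> (\<exists>q. p = AllN q \<and> bounded q)"

definition Sigma02 :: "fm \<Rightarrow> bool" where
  "Sigma02 p \<longleftrightarrow> (\<exists>q. p = ExN (AllN q) \<and> bounded q)"

definition env_ok :: "'m l2struct \<Rightarrow> (nat \<Rightarrow> 'm set) \<Rightarrow> bool" where
  "env_ok M E \<longleftrightarrow> (\<forall>i. E i \<in> s_sets M)"

text \<open>Basic axioms of RCA0 (Simpson I.2.4 (i)).\<close>
definition basic_axioms :: "'m l2struct \<Rightarrow> bool" where
  "basic_axioms M \<longleftrightarrow>
    (\<forall>m. s_add M m (s_one M) \<noteq> s_zero M) \<and>
    (\<forall>m n. s_add M m (s_one M) = s_add M n (s_one M) \<longrightarrow> m = n) \<and>
    (\<forall>m. s_add M m (s_zero M) = m) \<and>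
    (\<forall>m n. s_add M m (s_add M n (s_one M)) = s_add M (s_add M m n) (s_one M)) \<and>
    (\<forall>m. s_mul M m (s_zero M) = s_zero M) \<and>
    (\<forall>m n. s_mul M m (s_add M n (s_one M)) = s_add M (s_mul M m n) m) \<and>
    (\<forall>m. \<not> s_less M m (s_zero M)) \<and>
    (\<forall>m n. s_less M m (s_add M n (s_one M)) \<longleftrightarrow> (s_less M m n \<or> m = n))"

definition induction_for :: "'m l2struct \<Rightarrow> fm \<Rightarrow> bool" where
  "induction_for M p \<longleftrightarrow>
    (\<forall>e E. env_ok M E \<longrightarrow>
       sat M (case_nat (s_zero M) e) E p \<longrightarrow>
       (\<forall>n. sat M (case_nat n e) E p \<longrightarrow> sat M (case_nat (s_add M n (s_one M)) e) E p) \<longrightarrow>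
       (\<forall>n. sat M (case_nat n e) E p))"

definition Sigma01_IND :: "'m l2struct \<Rightarrow> bool" where
  "Sigma01_IND M \<longleftrightarrow> (\<forall>p. Sigma01 p \<longrightarrow> induction_for M p)"

definition Sigma02_IND :: "'m l2struct \<Rightarrow> bool" where
  "Sigma02_IND M \<longleftrightarrow> (\<forall>p. Sigma02 p \<longrightarrow> induction_for M p)"

definition Delta01_CA :: "'m l2struct \<Rightarrow> bool" where
  "Delta01_CA M \<longleftrightarrow>
    (\<forall>p q. Sigma01 p \<longrightarrow> Pi01 q \<longrightarrow>
      (\<forall>e E. env_ok M E \<longrightarrow>
         (\<forall>n. sat M (case_nat n e) E p \<longleftrightarrow> sat M (case_nat n e) E q) \<longrightarrow>
         (\<exists>X\<in>s_sets M. \<forall>n. n \<in> X \<longleftrightarrow> sat M (case_nat n e) E p)))"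

definition model_RCA0 :: "'m l2struct \<Rightarrow> bool" where
  "model_RCA0 M \<longleftrightarrow> basic_axioms M \<and> Sigma01_IND M \<and> Delta01_CA M"

text \<open>Cantor pairing as defined in the model: 2p = (i+j)(i+j+1) + 2i.\<close>
definition is_pair :: "'m l2struct \<Rightarrow> 'm \<Rightarrow> 'm \<Rightarrow> 'm \<Rightarrow> bool" where
  "is_pair M i j p \<longleftrightarrow>
     s_add M p p = s_add M (s_mul M (s_add M i j) (s_add M (s_add M i j) (s_one M))) (s_add M i i)"

definition coded3 :: "'m l2struct \<Rightarrow> 'm set \<Rightarrow> 'm \<Rightarrow> 'm \<Rightarrow> 'm \<Rightarrow> bool" where
  "coded3 M T a b c \<longleftrightarrow> (\<exists>p q. is_pair M a b p \<and> is_pair M p c q \<and> q \<in> T)"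

definition finite_semigroup :: "'m l2struct \<Rightarrow> 'm set \<Rightarrow> 'm set \<Rightarrow> bool" where
  "finite_semigroup M S T \<longleftrightarrow>
     S \<in> s_sets M \<and> T \<in> s_sets M \<and>
     (\<exists>k. \<forall>a\<in>S. s_less M a k) \<and>
     (\<forall>a\<in>S. \<forall>b\<in>S. \<exists>c\<in>S. coded3 M T a b c) \<and>
     (\<forall>a\<in>S. \<forall>b\<in>S. \<forall>c\<in>S. \<forall>c'\<in>S. coded3 M T a b c \<longrightarrow> coded3 M T a b c' \<longrightarrow> c = c') \<and>
     (\<forall>a\<in>S. \<forall>b\<in>S. \<forall>c\<in>S. \<forall>ab\<in>S. \<forall>bc\<in>S. \<forall>d\<in>S. \<forall>d'\<in>S.
        coded3 M T a b ab \<longrightarrow> coded3 M T b c bc \<longrightarrow>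
        coded3 M T ab c d \<longrightarrow> coded3 M T a bc d' \<longrightarrow> d = d')"

definition colouring :: "'m l2struct \<Rightarrow> 'm set \<Rightarrow> 'm set \<Rightarrow> bool" where
  "colouring M S C \<longleftrightarrow>
     C \<in> s_sets M \<and>
     (\<forall>i j. s_less M i j \<longrightarrow> (\<exists>a\<in>S. coded3 M C i j a)) \<and>
     (\<forall>i j a b. s_less M i j \<longrightarrow> coded3 M C i j a \<longrightarrow> coded3 M C i j b \<longrightarrow> a = b)"

definition additive :: "'m l2struct \<Rightarrow> 'm set \<Rightarrow> 'm set \<Rightarrow> 'm set \<Rightarrow> bool" where
  "additive M S T C \<longleftrightarrow>
     (\<forall>i j k a b c. s_less M i j \<longrightarrow> s_less M j k \<longrightarrow>
        coded3 M C i j a \<longrightarrow> coded3 M C j k b \<longrightarrow> coded3 M C i k c \<longrightarrow> coded3 M T a b c)"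

definition infinite_in :: "'m l2struct \<Rightarrow> 'm set \<Rightarrow> bool" where
  "infinite_in M I \<longleftrightarrow> (\<forall>n. \<exists>m\<in>I. s_less M n m)"

definition ART :: "'m l2struct \<Rightarrow> bool" where
  "ART M \<longleftrightarrow>
    (\<forall>S T C. finite_semigroup M S T \<longrightarrow> colouring M S C \<longrightarrow> additive M S T C \<longrightarrow>
       (\<exists>I\<in>s_sets M. \<exists>a\<in>S. infinite_in M I \<and>
          (\<forall>i\<in>I. \<forall>j\<in>I. s_less M i j \<longrightarrow> coded3 M C i j a)))"

end

(* Say that i and j merge at K if C(i,K) = C(j,K); by additivity they then stay merged at all later
   stages, so merging is an equivalence relation. It has finitely many classes: by Sigma-0-2 induction
   there would otherwise be coded sets of more than |S| pairwise unmerged numbers, and for a large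
   stage K the map sending i to C(i,K) would violate the finite pigeonhole principle. By
   Sigma-0-2 collection there are i0 and a such that infinitely many j merge with i0 and satisfy
   C(i0,j) = a. As there are finitely many classes, the set D of these j is Delta-0-1. Greedily put
   x in D into I if C(y,x) = a for all smaller y already in I: if I were bounded, then
   every y in I would have merged with i0 by some stage K, and any x in D beyond K has
   C(y,x) = C(i0,x) = a, hence could be added. *)
theory Submission
  imports Defs
begin

section \<open>Predicates defined by bounded formulas with parameters\<close>

text \<open>The model may be nonstandard, so the size of \<open>S\<close>, the number of classes and
  the length of a coded family can be infinite seen from outside. Every finiteness argument
  therefore has to be an induction inside \<open>M\<close>, over a formula of the right shape. Two
  devices make this manageable: \<open>tdef\<close> and \<open>bdef\<close> reduce the search for
  formulas to introduction rules, and finite sets are coded by single elements through divisibility,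
  which takes only semiring terms. Merging at a given stage is a bounded condition and merging at
  some stage is Sigma-0-1; so being the least element of a class is Pi-0-1, and the existence of a
  coded family of such elements is Sigma-0-2. The set D is at first sight only Sigma-0-1. Its
  universal definition comes from representatives below a fixed bound together with one stage by
  which every representative that ever merges with i0 has done so.\<close>

fun rent :: "(nat \<Rightarrow> nat) \<Rightarrow> trm \<Rightarrow> trm" where
  "rent f (Var i) = Var (f i)"
| "rent f Zero = Zero"
| "rent f One = One"
| "rent f (Add s t) = Add (rent f s) (rent f t)"
| "rent f (Mul s t) = Mul (rent f s) (rent f t)"

text \<open>Only meaningful on bounded formulas; number quantifiers lift \<^term>\<open>f\<close>.\<close>
fun renf :: "(nat \<Rightarrow> nat) \<Rightarrow> (nat \<Rightarrow> nat) \<Rightarrow> fm \<Rightarrow> fm" where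
  "renf f g (Eq s t) = Eq (rent f s) (rent f t)"
| "renf f g (Lt s t) = Lt (rent f s) (rent f t)"
| "renf f g (Mem t k) = Mem (rent f t) (g k)"
| "renf f g (Neg p) = Neg (renf f g p)"
| "renf f g (Conj p q) = Conj (renf f g p) (renf f g q)"
| "renf f g (Disj p q) = Disj (renf f g p) (renf f g q)"
| "renf f g (Imp p q) = Imp (renf f g p) (renf f g q)"
| "renf f g (BExN t p) = BExN (rent f t) (renf (case_nat 0 (\<lambda>i. Suc (f i))) g p)"
| "renf f g (BAllN t p) = BAllN (rent f t) (renf (case_nat 0 (\<lambda>i. Suc (f i))) g p)"
| "renf f g p = p"

lemma evalt_rent: "evalt M e (rent f t) = evalt M (\<lambda>i. e (f i)) t"
  by (induction t) auto

lemma case_nat_rename: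
  "(\<lambda>i. case_nat x e (case_nat 0 (\<lambda>i. Suc (f i)) i)) = case_nat x (\<lambda>i. e (f i))"
  by (auto simp: fun_eq_iff split: nat.splits)

lemma bounded_renf: "bounded p \<Longrightarrow> bounded (renf f g p)"
  by (induction p arbitrary: f) auto

lemma sat_renf:
  "bounded p \<Longrightarrow> sat M e E (renf f g p) \<longleftrightarrow> sat M (\<lambda>i. e (f i)) (\<lambda>i. E (g i)) p"
  by (induction p arbitrary: f e) (auto simp: evalt_rent case_nat_rename)

text \<open>A predicate on environments is \<open>n\<close>-ary definable if it is given by a bounded formula whose
  variables below \<open>n\<close> are free and whose remaining number and set variables are parameters.
  Hiding the parameters makes every element of the structure an admissible constant.\<close>

definition join :: "nat \<Rightarrow> (nat \<Rightarrow> 'a) \<Rightarrow> (nat \<Rightarrow> 'a) \<Rightarrow> nat \<Rightarrow> 'a" where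
  "join n e r = (\<lambda>i. if i < n then e i else r (i - n))"

text \<open>Makes room for the parameters of two formulas in one list without having to bound how
  many parameters either of them uses.\<close>

definition interleave :: "(nat \<Rightarrow> 'a) \<Rightarrow> (nat \<Rightarrow> 'a) \<Rightarrow> nat \<Rightarrow> 'a" where
  "interleave r s = (\<lambda>i. if even i then r (i div 2) else s (i div 2))"

definition tdef :: "'m l2struct \<Rightarrow> nat \<Rightarrow> ((nat \<Rightarrow> 'm) \<Rightarrow> 'm) \<Rightarrow> bool" where
  "tdef M n f \<longleftrightarrow> (\<exists>t r. \<forall>e. evalt M (join n e r) t = f e)"

definition bdef :: "'m l2struct \<Rightarrow> nat \<Rightarrow> ((nat \<Rightarrow> 'm) \<Rightarrow> bool) \<Rightarrow> bool" where
  "bdef M n P \<longleftrightarrow> (\<exists>q r E. bounded q \<and> env_ok M E \<and> (\<forall>e. sat M (join n e r) E q \<longleftrightarrow> P e))"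

lemma join_case_nat: "join (Suc n) (case_nat x e) r = case_nat x (join n e r)"
  by (auto simp: join_def fun_eq_iff split: nat.splits)

lemma join_ren_left: "(\<lambda>i. join n e (interleave r s) (if i < n then i else n + 2 * (i - n))) = join n e r"
  by (auto simp: join_def interleave_def fun_eq_iff)

lemma join_ren_right:
  "(\<lambda>i. join n e (interleave r s) (if i < n then i else n + 2 * (i - n) + 1)) = join n e s"
  by (auto simp: join_def interleave_def fun_eq_iff)

lemma interleave_even: "(\<lambda>i. interleave r s (2 * i)) = r"
  and interleave_odd: "(\<lambda>i. interleave r s (2 * i + 1)) = s"
  by (auto simp: interleave_def fun_eq_iff)

lemma env_ok_interleave: "env_ok M E \<Longrightarrow> env_ok M F \<Longrightarrow> env_ok M (interleave E F)"
  by (auto simp: env_ok_def interleave_def)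

lemma tdef_merge:
  assumes "tdef M n f" "tdef M n g"
  obtains s t r where "\<And>e. evalt M (join n e r) s = f e" "\<And>e. evalt M (join n e r) t = g e"
proof -
  obtain s r1 where s: "\<And>e. evalt M (join n e r1) s = f e" using assms(1) unfolding tdef_def by blast
  obtain t r2 where t: "\<And>e. evalt M (join n e r2) t = g e" using assms(2) unfolding tdef_def by blast
  show thesis
  proof (rule that)
    show "evalt M (join n e (interleave r1 r2)) (rent (\<lambda>i. if i < n then i else n + 2 * (i - n)) s) = f e" for e
      by (simp only: evalt_rent join_ren_left s)
    show "evalt M (join n e (interleave r1 r2)) (rent (\<lambda>i. if i < n then i else n + 2 * (i - n) + 1) t) = g e" for e
      by (simp only: evalt_rent join_ren_right t)
  qed
qed

lemma bdef_merge:
  assumes "bdef M n P" "bdef M n Q"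
  obtains p q r E where "bounded p" "bounded q" "env_ok M E"
    "\<And>e. sat M (join n e r) E p \<longleftrightarrow> P e" "\<And>e. sat M (join n e r) E q \<longleftrightarrow> Q e"
proof -
  obtain p r1 E1 where p: "bounded p" "env_ok M E1" "\<And>e. sat M (join n e r1) E1 p \<longleftrightarrow> P e"
    using assms(1) unfolding bdef_def by blast
  obtain q r2 E2 where q: "bounded q" "env_ok M E2" "\<And>e. sat M (join n e r2) E2 q \<longleftrightarrow> Q e"
    using assms(2) unfolding bdef_def by blast
  show thesis
  proof (rule that)
    show "sat M (join n e (interleave r1 r2)) (interleave E1 E2)
        (renf (\<lambda>i. if i < n then i else n + 2 * (i - n)) (\<lambda>i. 2 * i) p) \<longleftrightarrow> P e" for e
      by (simp only: sat_renf[OF p(1)] join_ren_left interleave_even p)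
    show "sat M (join n e (interleave r1 r2)) (interleave E1 E2)
        (renf (\<lambda>i. if i < n then i else n + 2 * (i - n) + 1) (\<lambda>i. 2 * i + 1) q) \<longleftrightarrow> Q e" for e
      by (simp only: sat_renf[OF q(1)] join_ren_right interleave_odd q)
  qed (use p q in \<open>auto intro: bounded_renf env_ok_interleave\<close>)
qed

lemma tdef_bdef_merge:
  assumes "tdef M n f" "bdef M (Suc n) P"
  obtains t p r E where "bounded p" "env_ok M E"
    "\<And>e. evalt M (join n e r) t = f e" "\<And>e. sat M (join (Suc n) e r) E p \<longleftrightarrow> P e"
proof -
  obtain t r1 where t: "\<And>e. evalt M (join n e r1) t = f e" using assms(1) unfolding tdef_def by blast
  obtain p r2 E where p: "bounded p" "env_ok M E" "\<And>e. sat M (join (Suc n) e r2) E p \<longleftrightarrow> P e"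
    using assms(2) unfolding bdef_def by blast
  show thesis
  proof (rule that)
    show "evalt M (join n e (interleave r1 r2)) (rent (\<lambda>i. if i < n then i else n + 2 * (i - n)) t) = f e" for e
      by (simp only: evalt_rent join_ren_left t)
    show "sat M (join (Suc n) e (interleave r1 r2)) E
        (renf (\<lambda>i. if i < Suc n then i else Suc n + 2 * (i - Suc n) + 1) (\<lambda>i. i) p) \<longleftrightarrow> P e" for e
      by (simp only: sat_renf[OF p(1)] join_ren_right p)
  qed (use p in \<open>auto intro: bounded_renf\<close>)
qed

lemma tdef_var: "j < n \<Longrightarrow> tdef M n (\<lambda>e. e j)"
  unfolding tdef_def by (rule exI[of _ "Var j"]) (simp add: join_def)

lemma tdef_const: "tdef M n (\<lambda>e. c)"
  unfolding tdef_def by (rule exI[of _ "Var n"], rule exI[of _ "\<lambda>_. c"]) (simp add: join_def)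

lemma tdef_add: "tdef M n f \<Longrightarrow> tdef M n g \<Longrightarrow> tdef M n (\<lambda>e. s_add M (f e) (g e))"
proof (erule (1) tdef_merge)
  fix s t r assume "\<And>e. evalt M (join n e r) s = f e" "\<And>e. evalt M (join n e r) t = g e"
  then show ?thesis unfolding tdef_def by (intro exI[of _ "Add s t"] exI[of _ r]) simp
qed

lemma tdef_mul: "tdef M n f \<Longrightarrow> tdef M n g \<Longrightarrow> tdef M n (\<lambda>e. s_mul M (f e) (g e))"
proof (erule (1) tdef_merge)
  fix s t r assume "\<And>e. evalt M (join n e r) s = f e" "\<And>e. evalt M (join n e r) t = g e"
  then show ?thesis unfolding tdef_def by (intro exI[of _ "Mul s t"] exI[of _ r]) simp
qed

lemma bdef_eq:
  assumes "X \<in> s_sets M" "tdef M n f" "tdef M n g" shows "bdef M n (\<lambda>e. f e = g e)"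
proof (rule tdef_merge[OF assms(2,3)])
  fix s t r assume "\<And>e. evalt M (join n e r) s = f e" "\<And>e. evalt M (join n e r) t = g e"
  then show ?thesis unfolding bdef_def using assms(1)
    by (intro exI[of _ "Eq s t"] exI[of _ r] exI[of _ "\<lambda>_. X"]) (simp add: env_ok_def)
qed

lemma bdef_less:
  assumes "X \<in> s_sets M" "tdef M n f" "tdef M n g" shows "bdef M n (\<lambda>e. s_less M (f e) (g e))"
proof (rule tdef_merge[OF assms(2,3)])
  fix s t r assume "\<And>e. evalt M (join n e r) s = f e" "\<And>e. evalt M (join n e r) t = g e"
  then show ?thesis unfolding bdef_def using assms(1)
    by (intro exI[of _ "Lt s t"] exI[of _ r] exI[of _ "\<lambda>_. X"]) (simp add: env_ok_def)
qed

lemma bdef_mem: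
  assumes "X \<in> s_sets M" "tdef M n f" shows "bdef M n (\<lambda>e. f e \<in> X)"
proof -
  obtain t r where "\<And>e. evalt M (join n e r) t = f e" using assms(2) unfolding tdef_def by blast
  then show ?thesis unfolding bdef_def using assms(1)
    by (intro exI[of _ "Mem t 0"] exI[of _ r] exI[of _ "\<lambda>_. X"]) (simp add: env_ok_def)
qed

lemma bdef_not: "bdef M n P \<Longrightarrow> bdef M n (\<lambda>e. \<not> P e)"
proof -
  assume "bdef M n P"
  then obtain p r E where "bounded p" "env_ok M E" "\<And>e. sat M (join n e r) E p \<longleftrightarrow> P e"
    unfolding bdef_def by blast
  then show ?thesis unfolding bdef_def by (intro exI[of _ "Neg p"] exI[of _ r] exI[of _ E]) simp
qed

lemma bdef_conj: "bdef M n P \<Longrightarrow> bdef M n Q \<Longrightarrow> bdef M n (\<lambda>e. P e \<and> Q e)"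
proof (erule (1) bdef_merge)
  fix p q r E assume "bounded p" "bounded q" "env_ok M E"
    "\<And>e. sat M (join n e r) E p \<longleftrightarrow> P e" "\<And>e. sat M (join n e r) E q \<longleftrightarrow> Q e"
  then show ?thesis unfolding bdef_def by (intro exI[of _ "Conj p q"] exI[of _ r] exI[of _ E]) simp
qed

lemma bdef_disj: "bdef M n P \<Longrightarrow> bdef M n Q \<Longrightarrow> bdef M n (\<lambda>e. P e \<or> Q e)"
  using bdef_not[OF bdef_conj[OF bdef_not[of M n P] bdef_not[of M n Q]]] by simp

lemma bdef_imp: "bdef M n P \<Longrightarrow> bdef M n Q \<Longrightarrow> bdef M n (\<lambda>e. P e \<longrightarrow> Q e)"
  using bdef_not[OF bdef_conj[OF _ bdef_not[of M n Q]], of P] by simp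

lemma bdef_iff: "bdef M n P \<Longrightarrow> bdef M n Q \<Longrightarrow> bdef M n (\<lambda>e. P e \<longleftrightarrow> Q e)"
  unfolding iff_conv_conj_imp by (intro bdef_conj bdef_imp)

lemma bdef_bex:
  assumes "tdef M n f" "bdef M (Suc n) (\<lambda>e. P (e 0) (\<lambda>i. e (Suc i)))"
  shows "bdef M n (\<lambda>e. \<exists>x. s_less M x (f e) \<and> P x e)"
proof (rule tdef_bdef_merge[OF assms])
  fix t p r E assume p: "bounded p" "env_ok M E" "\<And>e. evalt M (join n e r) t = f e"
    and s: "\<And>e. sat M (join (Suc n) e r) E p \<longleftrightarrow> P (e 0) (\<lambda>i. e (Suc i))"
  have "sat M (case_nat x (join n e r)) E p \<longleftrightarrow> P x e" for x e
    using s[of "case_nat x e"] by (simp add: join_case_nat)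
  then show ?thesis unfolding bdef_def using p
    by (intro exI[of _ "BExN t p"] exI[of _ r] exI[of _ E]) simp
qed

lemma bdef_ball:
  assumes "tdef M n f" "bdef M (Suc n) (\<lambda>e. P (e 0) (\<lambda>i. e (Suc i)))"
  shows "bdef M n (\<lambda>e. \<forall>x. s_less M x (f e) \<longrightarrow> P x e)"
proof -
  have "bdef M n (\<lambda>e. \<exists>x. s_less M x (f e) \<and> \<not> P x e)"
    by (intro bdef_bex assms bdef_not)
  from bdef_not[OF this] show ?thesis by simp
qed

lemma bdef_rename:
  assumes "bdef M m P" "\<And>i. i < m \<Longrightarrow> f i < n" shows "bdef M n (\<lambda>e. P (\<lambda>i. e (f i)))"
proof -
  obtain p r E where p: "bounded p" "env_ok M E" "\<And>e. sat M (join m e r) E p \<longleftrightarrow> P e"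
    using assms unfolding bdef_def by blast
  let ?g = "\<lambda>i. if i < m then f i else n + (i - m)"
  have "(\<lambda>i. join n e r (?g i)) = join m (\<lambda>i. e (f i)) r" for e
    using assms(2) by (auto simp: join_def fun_eq_iff)
  then have "sat M (join n e r) E (renf ?g (\<lambda>i. i) p) \<longleftrightarrow> P (\<lambda>i. e (f i))" for e
    by (simp add: sat_renf p)
  then show ?thesis unfolding bdef_def using p(1,2) bounded_renf by blast
qed

lemma bdef_rename1: "bdef M 1 (\<lambda>e. P (e 0)) \<Longrightarrow> j < n \<Longrightarrow> bdef M n (\<lambda>e. P (e j))"
  by (drule bdef_rename[where f = "\<lambda>_. j" and n = n]) auto

lemma bdef_rename2:
  "bdef M 2 (\<lambda>e. P (e 0) (e 1)) \<Longrightarrow> j < n \<Longrightarrow> k < n \<Longrightarrow> bdef M n (\<lambda>e. P (e j) (e k))"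
  by (drule bdef_rename[where f = "case_nat j (\<lambda>_. k)" and n = n]) (auto split: nat.splits)

lemma bdef_rename3:
  "bdef M 3 (\<lambda>e. P (e 0) (e 1) (e 2)) \<Longrightarrow> j < n \<Longrightarrow> k < n \<Longrightarrow> l < n
    \<Longrightarrow> bdef M n (\<lambda>e. P (e j) (e k) (e l))"
  by (drule bdef_rename[where f = "case_nat j (case_nat k (\<lambda>_. l))" and n = n])
    (auto simp: numeral_2_eq_2 split: nat.splits)

section \<open>Induction and comprehension for definable predicates\<close>

lemma sigma2_induct:
  assumes "Sigma02_IND M" and d: "bdef M 3 (\<lambda>e. P (e 2) (e 1) (e 0))"
    and 0: "\<exists>x. \<forall>y. P (s_zero M) x y"
    and S: "\<And>n. \<exists>x. \<forall>y. P n x y \<Longrightarrow> \<exists>x. \<forall>y. P (s_add M n (s_one M)) x y"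
  shows "\<exists>x. \<forall>y. P n x y"
proof -
  obtain p r E where p: "bounded p" "env_ok M E" "\<And>e. sat M (join 3 e r) E p \<longleftrightarrow> P (e 2) (e 1) (e 0)"
    using d unfolding bdef_def by blast
  \<comment> \<open>Index 0 belongs to the innermost quantifier, so the induction variable ends up
    at index 2, in front of the parameters \<open>r\<close>.\<close>
  have j: "case_nat y (case_nat x (case_nat n r)) = join 3 (case_nat y (case_nat x (\<lambda>_. n))) r" for x y n
    by (auto simp: join_def fun_eq_iff numeral_2_eq_2 numeral_3_eq_3 split: nat.splits)
  have s: "sat M (case_nat n r) E (ExN (AllN p)) \<longleftrightarrow> (\<exists>x. \<forall>y. P n x y)" for n
    by (simp add: j p numeral_2_eq_2)
  have "induction_for M (ExN (AllN p))"
    using assms(1) p(1) unfolding Sigma02_IND_def Sigma02_def by blast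
  with 0 S p(2) show ?thesis unfolding induction_for_def s[symmetric] by blast
qed

lemma delta1_comprehension:
  assumes "Delta01_CA M" and "bdef M 2 (\<lambda>e. P (e 1) (e 0))" "bdef M 2 (\<lambda>e. Q (e 1) (e 0))"
    and eq: "\<And>n. (\<exists>x. P n x) \<longleftrightarrow> (\<forall>x. Q n x)"
  shows "\<exists>X\<in>s_sets M. \<forall>n. n \<in> X \<longleftrightarrow> (\<exists>x. P n x)"
proof (rule bdef_merge[OF assms(2,3)])
  fix p q r E assume pq: "bounded p" "bounded q" "env_ok M E"
    "\<And>e. sat M (join 2 e r) E p \<longleftrightarrow> P (e 1) (e 0)" "\<And>e. sat M (join 2 e r) E q \<longleftrightarrow> Q (e 1) (e 0)"
  have j: "case_nat x (case_nat n r) = join 2 (case_nat x (\<lambda>_. n)) r" for x n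
    by (auto simp: join_def fun_eq_iff numeral_2_eq_2 split: nat.splits)
  have s: "sat M (case_nat n r) E (ExN p) \<longleftrightarrow> (\<exists>x. P n x)" "sat M (case_nat n r) E (AllN q) \<longleftrightarrow> (\<forall>x. Q n x)" for n
    by (simp_all add: j pq)
  show ?thesis
    using assms(1) pq(1-3) eq unfolding Delta01_CA_def Sigma01_def Pi01_def s[symmetric] by blast
qed

section \<open>Arithmetic in the model\<close>

text \<open>\<open>sets_nonempty\<close> supplies a set environment: without one
  \<open>env_ok\<close> is unsatisfiable, and induction and comprehension say nothing.\<close>

locale ind2_model =
  fixes M :: "'m l2struct"
  assumes basic: "basic_axioms M" and ind2: "Sigma02_IND M" and ca: "Delta01_CA M"
    and sets_nonempty: "s_sets M \<noteq> {}"
begin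

abbreviation zero ("\<zero>") where "\<zero> \<equiv> s_zero M"
abbreviation one ("\<one>") where "\<one> \<equiv> s_one M"
abbreviation plus (infixl "\<oplus>" 65) where "x \<oplus> y \<equiv> s_add M x y"
abbreviation times (infixl "\<otimes>" 70) where "x \<otimes> y \<equiv> s_mul M x y"
abbreviation less (infix "\<prec>" 50) where "x \<prec> y \<equiv> s_less M x y"

lemma Suc_neq_0: "m \<oplus> \<one> \<noteq> \<zero>"
  and Suc_inj: "m \<oplus> \<one> = n \<oplus> \<one> \<Longrightarrow> m = n"
  and add_0: "m \<oplus> \<zero> = m"
  and add_Suc: "m \<oplus> (n \<oplus> \<one>) = (m \<oplus> n) \<oplus> \<one>"
  and mul_0: "m \<otimes> \<zero> = \<zero>"
  and mul_Suc: "m \<otimes> (n \<oplus> \<one>) = m \<otimes> n \<oplus> m"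
  and not_less_0: "\<not> m \<prec> \<zero>"
  and less_Suc: "m \<prec> n \<oplus> \<one> \<longleftrightarrow> m \<prec> n \<or> m = n"
  using basic unfolding basic_axioms_def by blast+

lemma tdef_eqI: "tdef M n f \<Longrightarrow> tdef M n g \<Longrightarrow> bdef M n (\<lambda>e. f e = g e)"
  using sets_nonempty bdef_eq by blast

lemma tdef_lessI: "tdef M n f \<Longrightarrow> tdef M n g \<Longrightarrow> bdef M n (\<lambda>e. f e \<prec> g e)"
  using sets_nonempty bdef_less by blast

lemmas bdef_intros =
  tdef_var tdef_const tdef_add tdef_mul tdef_eqI tdef_lessI bdef_mem
  bdef_not bdef_conj bdef_disj bdef_imp bdef_iff bdef_bex bdef_ball

lemma sigma2_ind:
  assumes "bdef M 3 (\<lambda>e. P (e 2) (e 1) (e 0))" "\<exists>x. \<forall>y. P \<zero> x y"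
    "\<And>n. \<exists>x. \<forall>y. P n x y \<Longrightarrow> \<exists>x. \<forall>y. P (n \<oplus> \<one>) x y"
  shows "\<exists>x. \<forall>y. P n x y"
  using sigma2_induct[OF ind2, of P n] assms by blast

text \<open>A dummy existential quantifier makes the formula Sigma-0-2; the next two rules pad with
  dummy quantifiers likewise.\<close>

lemma pi1_ind:
  assumes "bdef M 2 (\<lambda>e. P (e 0) (e 1))" "\<And>y. P \<zero> y"
    "\<And>n. (\<And>y. P n y) \<Longrightarrow> (\<And>y. P (n \<oplus> \<one>) y)"
  shows "P n y"
  using sigma2_ind[of "\<lambda>n x y. P n y" n] assms bdef_rename2[OF assms(1), of 2 3 0] by auto

lemma sigma1_ind:
  assumes "bdef M 2 (\<lambda>e. P (e 0) (e 1))" "\<exists>x. P \<zero> x"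
    "\<And>n. \<exists>x. P n x \<Longrightarrow> \<exists>x. P (n \<oplus> \<one>) x"
  shows "\<exists>x. P n x"
  using sigma2_ind[of "\<lambda>n x y. P n x" n] assms bdef_rename2[OF assms(1), of 2 3 1] by auto

lemma bounded_ind [case_names def 0 Suc]:
  assumes "bdef M 1 (\<lambda>e. P (e 0))" "P \<zero>" "\<And>n. P n \<Longrightarrow> P (n \<oplus> \<one>)"
  shows "P n"
  using sigma2_ind[of "\<lambda>n x y. P n" n] assms bdef_rename1[OF assms(1), of 2 3] by auto

section \<open>Semiring laws\<close>

lemma Add_assoc: "(a \<oplus> b) \<oplus> c = a \<oplus> (b \<oplus> c)"
proof (induction c rule: bounded_ind)
qed (auto intro!: bdef_intros simp: add_0 add_Suc)

lemma Add_0_left: "\<zero> \<oplus> a = a"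
proof (induction a rule: bounded_ind)
qed (auto intro!: bdef_intros simp: add_0 add_Suc)

lemma Add_Suc_left: "(a \<oplus> \<one>) \<oplus> b = (a \<oplus> b) \<oplus> \<one>"
proof (induction b rule: bounded_ind)
qed (auto intro!: bdef_intros simp: add_0 add_Suc)

lemma Add_commute: "a \<oplus> b = b \<oplus> a"
proof (induction b rule: bounded_ind)
qed (auto intro!: bdef_intros simp: add_0 add_Suc Add_0_left Add_Suc_left)

lemma Add_left_commute: "b \<oplus> (a \<oplus> c) = a \<oplus> (b \<oplus> c)"
  by (metis Add_assoc Add_commute)

lemma Add_cancel: "c \<oplus> a = c \<oplus> b \<Longrightarrow> a = b"
proof -
  have "a \<oplus> c = b \<oplus> c \<longrightarrow> a = b"
  proof (induction c rule: bounded_ind)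
  qed (auto intro!: bdef_intros simp: add_0 add_Suc dest: Suc_inj)
  then show "c \<oplus> a = c \<oplus> b \<Longrightarrow> a = b" by (simp add: Add_commute)
qed

lemma Mul_0_left: "\<zero> \<otimes> a = \<zero>"
proof (induction a rule: bounded_ind)
qed (auto intro!: bdef_intros simp: add_0 mul_0 mul_Suc)

lemma Mul_Suc_left: "(a \<oplus> \<one>) \<otimes> b = a \<otimes> b \<oplus> b"
proof (induction b rule: bounded_ind)
qed (auto intro!: bdef_intros simp: add_0 mul_0 mul_Suc Add_assoc Add_commute Add_left_commute)

lemma Mul_commute: "a \<otimes> b = b \<otimes> a"
proof (induction b rule: bounded_ind)
qed (auto intro!: bdef_intros simp: mul_0 mul_Suc Mul_0_left Mul_Suc_left)

lemma Mul_distrib: "(a \<oplus> b) \<otimes> c = a \<otimes> c \<oplus> b \<otimes> c"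
proof (induction c rule: bounded_ind)
qed (auto intro!: bdef_intros simp: mul_0 mul_Suc add_0 Add_assoc Add_commute Add_left_commute)

lemma Mul_distrib_left: "c \<otimes> (a \<oplus> b) = c \<otimes> a \<oplus> c \<otimes> b"
  by (simp add: Mul_commute[of c] Mul_distrib)

lemma Mul_assoc: "(a \<otimes> b) \<otimes> c = a \<otimes> (b \<otimes> c)"
proof (induction c rule: bounded_ind)
qed (auto intro!: bdef_intros simp: mul_0 mul_Suc Mul_distrib Mul_commute[of a])

lemma Mul_1: "\<one> \<otimes> a = a"
  using Mul_Suc_left[of \<zero> a] by (simp add: Add_0_left Mul_0_left)

section \<open>Order and truncated subtraction\<close>

lemma less_add_Suc: "a \<prec> a \<oplus> (c \<oplus> \<one>)"
proof (induction c rule: bounded_ind)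
qed (auto intro!: bdef_intros simp: Add_0_left add_0 add_Suc less_Suc)

lemma less_iff_add: "a \<prec> b \<longleftrightarrow> (\<exists>c. b = a \<oplus> (c \<oplus> \<one>))"
proof
  \<comment> \<open>The bound \<open>c \<prec> b\<close> keeps the induction formula
    bounded.\<close>
  have "a \<prec> b \<longrightarrow> (\<exists>c. c \<prec> b \<and> b = a \<oplus> (c \<oplus> \<one>))"
  proof (induction b rule: bounded_ind)
    case 0
    show ?case by (auto simp: not_less_0)
  next
    case (Suc b)
    have *: "c \<prec> b" if "b = a \<oplus> (c \<oplus> \<one>)" for b c
      using that less_add_Suc[of c a] by (simp add: Add_commute Add_left_commute)
    show ?case
    proof
      assume "a \<prec> b \<oplus> \<one>"
      then have "\<exists>c. b \<oplus> \<one> = a \<oplus> (c \<oplus> \<one>)"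
        using Suc by (metis less_Suc Add_0_left add_Suc)
      then show "\<exists>c. c \<prec> b \<oplus> \<one> \<and> b \<oplus> \<one> = a \<oplus> (c \<oplus> \<one>)" using * by blast
    qed
  qed (auto intro!: bdef_intros)
  then show "a \<prec> b \<Longrightarrow> \<exists>c. b = a \<oplus> (c \<oplus> \<one>)" by blast
qed (use less_add_Suc in blast)

lemma zero_or_Suc: "a = \<zero> \<or> (\<exists>b. a = b \<oplus> \<one>)"
proof -
  have "a = \<zero> \<or> (\<exists>b. b \<prec> a \<and> a = b \<oplus> \<one>)"
  proof (induction a rule: bounded_ind)
  qed (auto intro!: bdef_intros simp: less_Suc)
  then show ?thesis by blast
qed

abbreviation leq (infix "\<preceq>" 50) where "x \<preceq> y \<equiv> x \<prec> y \<or> x = y"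

lemma le_iff_add: "a \<preceq> b \<longleftrightarrow> (\<exists>c. b = a \<oplus> c)"
  unfolding less_iff_add using zero_or_Suc add_0 by metis

lemma less_linear: "a \<prec> b \<or> a = b \<or> b \<prec> a"
proof (induction a rule: bounded_ind)
  case 0
  show ?case using zero_or_Suc[of b] less_add_Suc[of \<zero>] by (auto simp: Add_0_left)
next
  case (Suc a)
  have "a \<oplus> \<one> \<prec> b \<or> a \<oplus> \<one> = b" if "a \<prec> b"
    using that zero_or_Suc unfolding less_iff_add
    by (metis Add_commute Add_left_commute add_0)
  then show ?case using Suc less_Suc by blast
qed (auto intro!: bdef_intros)

lemma less_irrefl: "\<not> a \<prec> a"
proof
  assume "a \<prec> a"
  then obtain c where "a \<oplus> \<zero> = a \<oplus> (c \<oplus> \<one>)" unfolding less_iff_add by (auto simp: add_0)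
  then show False using Add_cancel Suc_neq_0 by metis
qed

lemma less_trans': "a \<prec> b \<Longrightarrow> b \<prec> c \<Longrightarrow> a \<prec> c"
  unfolding less_iff_add by (metis Add_assoc)

text \<open>Truncated subtraction; it only serves to make the class facts available.\<close>
definition minus (infixl "\<ominus>" 65) where
  "a \<ominus> b = (if \<exists>c. a = b \<oplus> c then THE c. a = b \<oplus> c else \<zero>)"

lemma add_minus: "(b \<oplus> c) \<ominus> b = c"
proof -
  have "(THE c'. b \<oplus> c = b \<oplus> c') = c" by (rule the_equality) (auto dest: Add_cancel)
  then show ?thesis unfolding minus_def by auto
qed

lemma minus_less: "a \<prec> b \<Longrightarrow> a \<ominus> b = \<zero>"
  unfolding minus_def using le_iff_add less_irrefl less_trans' by metis

lemma le_minus_cases: obtains (le) c where "a = b \<oplus> c" "a \<ominus> b = c" | (less) "a \<prec> b" "a \<ominus> b = \<zero>"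
  using add_minus minus_less less_linear le_iff_add by metis

lemma minus_minus: "a \<ominus> b \<ominus> c = a \<ominus> (b \<oplus> c)"
proof (cases a b rule: le_minus_cases)
  case (le d)
  show ?thesis
  proof (cases d c rule: le_minus_cases)
    case (le e)
    then have "a = (b \<oplus> c) \<oplus> e" using \<open>a = b \<oplus> d\<close> by (simp add: Add_assoc)
    then have "a \<ominus> (b \<oplus> c) = e" by (simp only: add_minus)
    then show ?thesis using le \<open>a \<ominus> b = d\<close> by simp
  next
    case less
    then have "a \<prec> b \<oplus> c" unfolding \<open>a = b \<oplus> d\<close> less_iff_add by (metis Add_assoc)
    then show ?thesis using less \<open>a \<ominus> b = d\<close> minus_less by simp
  qed
next
  case less
  then have "a \<prec> b \<oplus> c" unfolding less_iff_add by (metis Add_assoc Add_commute)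
  moreover have "\<zero> \<ominus> c = \<zero>"
    by (metis add_minus le_minus_cases not_less_0 zero_or_Suc minus_less Suc_neq_0 Add_0_left add_0 less_linear)
  ultimately show ?thesis using less minus_less by simp
qed

lemma Mul_mono_strict: "a \<prec> b \<Longrightarrow> \<zero> \<prec> c \<Longrightarrow> c \<otimes> a \<prec> c \<otimes> b"
proof -
  assume "a \<prec> b" "\<zero> \<prec> c"
  then obtain d e where "b = a \<oplus> (d \<oplus> \<one>)" "c = e \<oplus> \<one>"
    unfolding less_iff_add by (metis Add_0_left)
  then have "c \<otimes> b = c \<otimes> a \<oplus> ((c \<otimes> d \<oplus> e) \<oplus> \<one>)"
    by (simp add: Mul_distrib_left Mul_distrib Mul_1 Mul_commute[of e \<one>] Add_assoc Add_commute Add_left_commute)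
  then show ?thesis unfolding less_iff_add by blast
qed

lemma Mul_minus: "a \<otimes> (b \<ominus> c) = a \<otimes> b \<ominus> a \<otimes> c"
proof (cases b c rule: le_minus_cases)
  case (le d)
  then have "a \<otimes> b = a \<otimes> c \<oplus> a \<otimes> d" by (simp add: Mul_commute[of a] Mul_distrib)
  then show ?thesis using le add_minus by simp
next
  case less
  then have "a \<otimes> b \<prec> a \<otimes> c \<or> a = \<zero>"
    using Mul_mono_strict zero_or_Suc less_add_Suc[of \<zero>] Add_0_left by metis
  then show ?thesis using less minus_less Mul_0_left add_minus[of \<zero> \<zero>]
    by (auto simp: Mul_0_left mul_0 add_0)
qed

text \<open>Makes \<open>algebra_simps\<close> and the library's order and divisibility lemmas
  usable for elements of \<open>M\<close>.\<close>

sublocale arith: linordered_semidom plus minus "\<lambda>x y. x \<preceq> y" less zero times one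
proof
  show "a \<oplus> b \<preceq> a \<oplus> c" if "b \<preceq> c" for a b c
    using that unfolding le_iff_add by (metis Add_assoc)
  show "a \<ominus> b \<oplus> b = a" if "b \<preceq> a" for a b
    using that unfolding le_iff_add by (metis Add_commute add_minus)
  show "a \<otimes> b \<noteq> \<zero>" if "a \<noteq> \<zero>" "b \<noteq> \<zero>" for a b
    using that zero_or_Suc Mul_Suc_left mul_Suc add_Suc Suc_neq_0 by metis
  show "\<zero> \<noteq> \<one>" using Suc_neq_0[of \<zero>] by (simp add: Add_0_left)
  show "\<zero> \<prec> \<one>" using less_Suc[of \<zero> \<zero>] by (simp add: Add_0_left)
  show "a \<oplus> b = b \<oplus> a" for a b by (rule Add_commute)
  show "a \<otimes> b = b \<otimes> a" for a b by (rule Mul_commute)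
  show "c \<otimes> a \<prec> c \<otimes> b" if "a \<prec> b" "\<zero> \<prec> c" for a b c
    using that by (rule Mul_mono_strict)
  show "x \<preceq> y \<or> y \<preceq> x" for x y using less_linear by blast
qed (use less_irrefl less_trans' Mul_1 in \<open>auto simp: Add_assoc add_minus minus_minus Mul_minus Mul_mono_strict
    Mul_assoc Mul_distrib Mul_distrib_left Mul_1 add_0 mul_0 Mul_0_left Add_0_left\<close>)


lemma zero_le: "\<zero> \<preceq> x"
  using le_iff_add Add_0_left by metis

lemma zero_less_Suc: "\<zero> \<prec> x \<oplus> \<one>"
  using zero_le less_Suc by blast

lemma less_one: "x \<prec> \<one> \<longleftrightarrow> x = \<zero>"
  using less_Suc[of x \<zero>] by (simp add: Add_0_left not_less_0)

lemma tdef_shift: "tdef M n f \<Longrightarrow> tdef M (Suc n) (\<lambda>e. f (\<lambda>i. e (Suc i)))"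
proof -
  assume "tdef M n f"
  then obtain t r where t: "\<And>e. evalt M (join n e r) t = f e" unfolding tdef_def by blast
  have "(\<lambda>i. join (Suc n) e r (Suc i)) = join n (\<lambda>i. e (Suc i)) r" for e
    by (auto simp: join_def fun_eq_iff)
  then have "evalt M (join (Suc n) e r) (rent Suc t) = f (\<lambda>i. e (Suc i))" for e
    by (simp add: evalt_rent t)
  then show ?thesis unfolding tdef_def by blast
qed

text \<open>In place of substituting terms into formulas, the value of each term is named by a
  quantified variable bounded by the successor of that value.\<close>

lemma bdef_subst2:
  assumes "bdef M 2 (\<lambda>e. P (e 0) (e 1))" "tdef M n f" "tdef M n g"
  shows "bdef M n (\<lambda>e. P (f e) (g e))"
proof -
  have P: "bdef M (Suc (Suc n)) (\<lambda>e. P (e (Suc 0)) (e 0))"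
    by (rule bdef_rename2[OF assms(1)]) simp_all
  have Q: "bdef M (Suc n) (\<lambda>e. \<exists>y. y \<prec> g (\<lambda>i. e (Suc i)) \<oplus> \<one> \<and> (y = g (\<lambda>i. e (Suc i)) \<and> P (e 0) y))"
    by (rule bdef_bex, rule tdef_add[OF tdef_shift[OF assms(3)] tdef_const],
      rule bdef_conj[OF tdef_eqI[OF tdef_var tdef_shift[OF tdef_shift[OF assms(3)]]] P]) simp
  have "bdef M n (\<lambda>e. \<exists>x. x \<prec> f e \<oplus> \<one> \<and> (x = f e \<and> (\<exists>y. y \<prec> g e \<oplus> \<one> \<and> (y = g e \<and> P x y))))"
    by (rule bdef_bex, rule tdef_add[OF assms(2) tdef_const],
      rule bdef_conj[OF tdef_eqI[OF tdef_var tdef_shift[OF assms(2)]] Q]) simp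
  then show ?thesis by (simp add: less_Suc)
qed

abbreviation dvd (infix "dvd\<^sub>M" 50) where "a dvd\<^sub>M b \<equiv> dvd.dvd times a b"

lemma bdef_dvd:
  assumes "tdef M n f" "tdef M n g" shows "bdef M n (\<lambda>e. f e dvd\<^sub>M g e)"
proof -
  \<comment> \<open>A quotient can be chosen at most \<open>b\<close>: a nonzero \<open>a\<close>
    gives \<open>k \<preceq> a \<otimes> k\<close>, and for \<open>a = \<zero>\<close> the quotient
    zero serves.\<close>
  have *: "a dvd\<^sub>M b \<longleftrightarrow> (\<exists>k. k \<prec> b \<oplus> \<one> \<and> b = a \<otimes> k)" for a b
  proof
    assume "a dvd\<^sub>M b"
    then obtain k where k: "b = a \<otimes> k" by (elim arith.dvdE)
    show "\<exists>k. k \<prec> b \<oplus> \<one> \<and> b = a \<otimes> k"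
    proof (cases "a = \<zero>")
      case True
      then show ?thesis using k by (auto simp: less_Suc Mul_0_left less_one)
    next
      case False
      then obtain c where "b = k \<oplus> c \<otimes> k" using k zero_or_Suc[of a] by (auto simp: Mul_Suc_left Add_commute)
      then show ?thesis using k le_iff_add less_Suc by blast
    qed
  qed (auto intro: arith.dvdI)
  show ?thesis unfolding *
    by (intro bdef_intros assms tdef_shift) auto
qed

subsection \<open>Codes of finite sets\<close>

text \<open>A polynomial pairing, hence a term of the language, whereas the Cantor pairing of
  \<open>is_pair\<close> involves halving. It is injective because \<open>b\<close> is at most
  \<open>a \<oplus> b\<close>, while the squares of \<open>s\<close> and
  \<open>s \<oplus> \<one>\<close> differ by more than \<open>s\<close>.\<close>

definition pr where "pr a b = (a \<oplus> b) \<otimes> (a \<oplus> b) \<oplus> b"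

lemma tdef_pr: "tdef M n f \<Longrightarrow> tdef M n g \<Longrightarrow> tdef M n (\<lambda>e. pr (f e) (g e))"
  unfolding pr_def by (intro bdef_intros)

lemma pr_mono_strict: "a \<prec> a' \<Longrightarrow> b \<prec> b' \<Longrightarrow> pr a b \<prec> pr a' b'"
  unfolding pr_def
  by (intro arith.add_strict_mono arith.mult_strict_mono zero_le) (use arith.le_less_trans[OF zero_le] arith.add_pos_pos in blast)+

lemma le_square: "x \<preceq> x \<otimes> x"
  using zero_or_Suc[of x] zero_le le_iff_add mul_Suc Add_commute by metis

lemma le_pr: "a \<preceq> pr a b" "b \<preceq> pr a b"
proof -
  have "a \<preceq> a \<oplus> b" using le_iff_add by blast
  also note le_square
  also have "(a \<oplus> b) \<otimes> (a \<oplus> b) \<preceq> pr a b" unfolding pr_def le_iff_add by blast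
  finally show "a \<preceq> pr a b" .
  show "b \<preceq> pr a b" unfolding pr_def le_iff_add using Add_commute by blast
qed

lemma pr_less: "a \<oplus> b \<prec> c \<oplus> d \<Longrightarrow> pr a b \<prec> pr c d"
proof -
  let ?s = "a \<oplus> b"
  assume "?s \<prec> c \<oplus> d"
  then obtain r where r: "c \<oplus> d = ?s \<oplus> (r \<oplus> \<one>)" unfolding less_iff_add by blast
  \<comment> \<open>With \<open>s = a + b\<close>, this expands \<open>(s + r + 1)^2 + d\<close>
    minus \<open>s^2 + b\<close>; the part \<open>2 s - b\<close> is \<open>2 a + b\<close>.\<close>
  have "pr c d = pr a b \<oplus> ((?s \<otimes> r \<oplus> r \<otimes> ?s \<oplus> r \<otimes> r \<oplus> r \<oplus> r \<oplus> a \<oplus> a \<oplus> b \<oplus> d) \<oplus> \<one>)"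
    unfolding r pr_def by (simp add: algebra_simps)
  then show ?thesis unfolding less_iff_add by (rule exI)
qed

lemma pr_inj: "pr a b = pr c d \<longleftrightarrow> a = c \<and> b = d"
proof
  assume eq: "pr a b = pr c d"
  then have s: "a \<oplus> b = c \<oplus> d" using pr_less less_linear less_irrefl by metis
  then have "b = d" using eq unfolding pr_def by simp
  with s show "a = c \<and> b = d" by simp
qed simp

text \<open>Follows from \<open>p \<preceq> p \<oplus> p\<close>. It bounds the two existential
  quantifiers inside \<open>coded3\<close>, which thereby becomes a bounded condition.\<close>

lemma is_pair_le: "is_pair M a b p \<Longrightarrow> p \<prec> (a \<oplus> b) \<otimes> ((a \<oplus> b) \<oplus> \<one>) \<oplus> (a \<oplus> a) \<oplus> \<one>"
  unfolding is_pair_def less_Suc le_iff_add by metis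

lemma bdef_coded3:
  assumes "X \<in> s_sets M" "tdef M n f" "tdef M n g" "tdef M n h"
  shows "bdef M n (\<lambda>e. coded3 M X (f e) (g e) (h e))"
proof -
  have *: "coded3 M X a b c \<longleftrightarrow>
      (\<exists>p. p \<prec> (a \<oplus> b) \<otimes> ((a \<oplus> b) \<oplus> \<one>) \<oplus> (a \<oplus> a) \<oplus> \<one> \<and> is_pair M a b p \<and>
        (\<exists>q. q \<prec> (p \<oplus> c) \<otimes> ((p \<oplus> c) \<oplus> \<one>) \<oplus> (p \<oplus> p) \<oplus> \<one> \<and> is_pair M p c q \<and> q \<in> X))" for a b c
    unfolding coded3_def using is_pair_le by blast
  show ?thesis unfolding * unfolding is_pair_def
    by (intro bdef_intros assms tdef_shift) auto
qed

text \<open>Goedel's coding: the set coded by \<^term>\<open>pr (pr p d) m\<close> consists of the \<^term>\<open>x\<close> below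
  \<^term>\<open>m\<close> for which \<open>1 + (x + 1) d\<close> divides \<^term>\<open>p\<close>.\<close>
definition modulus where "modulus d x = \<one> \<oplus> (x \<oplus> \<one>) \<otimes> d"

definition elt (infix "\<epsilon>" 50) where
  "x \<epsilon> w \<longleftrightarrow> (\<exists>p. p \<prec> w \<oplus> \<one> \<and> (\<exists>d. d \<prec> w \<oplus> \<one> \<and> (\<exists>m. m \<prec> w \<oplus> \<one> \<and>
     w = pr (pr p d) m \<and> x \<prec> m \<and> modulus d x dvd\<^sub>M p)))"

lemma bdef_elt: "tdef M n f \<Longrightarrow> tdef M n g \<Longrightarrow> bdef M n (\<lambda>e. f e \<epsilon> g e)"
proof (rule bdef_subst2)
  show "bdef M 2 (\<lambda>e. e 0 \<epsilon> e 1)"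
    unfolding elt_def modulus_def by (intro bdef_intros bdef_dvd tdef_pr; simp)
qed

lemma elt_pr: "x \<epsilon> pr (pr p d) m \<longleftrightarrow> x \<prec> m \<and> modulus d x dvd\<^sub>M p"
proof -
  have "m \<preceq> pr (pr p d) m" "p \<preceq> pr (pr p d) m" "d \<preceq> pr (pr p d) m"
    using le_pr arith.order_trans by blast+
  then show ?thesis unfolding elt_def by (auto simp: pr_inj less_Suc)
qed

lemma elt_less: "x \<epsilon> w \<Longrightarrow> x \<prec> w"
proof -
  assume "x \<epsilon> w"
  then obtain p d m where "w = pr (pr p d) m" "x \<prec> m" unfolding elt_def by (elim exE conjE)
  then show "x \<prec> w" using arith.less_le_trans[OF _ le_pr(2)] by simp
qed

text \<open>A stand-in for the factorial, built by multiplying in one factor per step. Such a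
  \<open>d\<close> makes the moduli of distinct numbers below \<open>m\<close> coprime.\<close>

lemma common_multiple: "\<exists>d. \<zero> \<prec> d \<and> (\<forall>x. x \<prec> m \<oplus> \<one> \<longrightarrow> \<zero> \<prec> x \<longrightarrow> x dvd\<^sub>M d)"
proof (rule sigma1_ind[of "\<lambda>m d. \<zero> \<prec> d \<and> (\<forall>x. x \<prec> m \<oplus> \<one> \<longrightarrow> \<zero> \<prec> x \<longrightarrow> x dvd\<^sub>M d)"])
  show "\<exists>d. \<zero> \<prec> d \<and> (\<forall>x. x \<prec> \<zero> \<oplus> \<one> \<longrightarrow> \<zero> \<prec> x \<longrightarrow> x dvd\<^sub>M d)"
    by (rule exI[of _ \<one>]) (auto simp: Add_0_left less_one less_irrefl)
next
  fix n assume "\<exists>d. \<zero> \<prec> d \<and> (\<forall>x. x \<prec> n \<oplus> \<one> \<longrightarrow> \<zero> \<prec> x \<longrightarrow> x dvd\<^sub>M d)"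
  then obtain d where d: "\<zero> \<prec> d" "\<And>x. x \<prec> n \<oplus> \<one> \<Longrightarrow> \<zero> \<prec> x \<Longrightarrow> x dvd\<^sub>M d" by blast
  have "\<zero> \<prec> n \<oplus> \<one>" using zero_le by (simp add: less_Suc)
  then have "\<zero> \<prec> d \<otimes> (n \<oplus> \<one>)" using d(1) arith.mult_pos_pos by blast
  moreover have "x dvd\<^sub>M d \<otimes> (n \<oplus> \<one>)" if "x \<prec> n \<oplus> \<one> \<oplus> \<one>" "\<zero> \<prec> x" for x
    using that d(2) by (auto simp: less_Suc[of x "n \<oplus> \<one>"] intro: arith.dvd_mult2 arith.dvd_triv_right)
  ultimately show "\<exists>d. \<zero> \<prec> d \<and> (\<forall>x. x \<prec> n \<oplus> \<one> \<oplus> \<one> \<longrightarrow> \<zero> \<prec> x \<longrightarrow> x dvd\<^sub>M d)" by blast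
qed (intro bdef_intros bdef_dvd; simp)

text \<open>For \<open>i \<prec> n\<close>,
  \<open>(n + 1) * modulus d i - (i + 1) * modulus d n\<close> is \<open>n - i\<close>, a divisor of
  \<open>d\<close>. Scaling up to \<open>p * d\<close> shows that \<open>modulus d i\<close> divides
  \<open>p * d\<close>; being 1 plus a multiple of \<open>d\<close>, it then divides
  \<open>p\<close> as well.\<close>

lemma modulus_coprime:
  assumes "i \<noteq> n" "i \<prec> m" "n \<prec> m" and d: "\<And>x. x \<prec> m \<oplus> \<one> \<Longrightarrow> \<zero> \<prec> x \<Longrightarrow> x dvd\<^sub>M d"
    and dv: "modulus d i dvd\<^sub>M p \<otimes> modulus d n"
  shows "modulus d i dvd\<^sub>M p"
proof -
  have ex: "\<exists>c e. b = a \<oplus> c \<and> d = c \<otimes> e" if ab: "a \<prec> b" "b \<prec> m" for a b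
  proof -
    obtain c where b: "b = a \<oplus> (c \<oplus> \<one>)" using ab(1) unfolding less_iff_add by (elim exE)
    have "c \<oplus> \<one> \<preceq> b" unfolding le_iff_add by (rule exI[of _ a]) (simp add: b Add_commute)
    then have "c \<oplus> \<one> \<prec> m \<oplus> \<one>" unfolding less_Suc using ab(2) arith.le_less_trans by blast
    then have "(c \<oplus> \<one>) dvd\<^sub>M d" using d zero_less_Suc by blast
    then obtain e where "d = (c \<oplus> \<one>) \<otimes> e" by (elim arith.dvdE)
    with b show ?thesis by blast
  qed
  have "modulus d i dvd\<^sub>M p \<otimes> d"
  proof (cases "i \<prec> n")
    \<comment> \<open>Subtraction is truncated, so the identity is written with sums, once for each
      order of \<open>i\<close> and \<open>n\<close>.\<close>
    case True
    then obtain c e where c: "n = i \<oplus> c" "d = c \<otimes> e" using ex assms(3) by blast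
    have "(p \<otimes> e \<otimes> (n \<oplus> \<one>)) \<otimes> modulus d i = (p \<otimes> modulus d n) \<otimes> (e \<otimes> (i \<oplus> \<one>)) \<oplus> p \<otimes> d"
      unfolding modulus_def c by (simp add: algebra_simps)
    moreover have "modulus d i dvd\<^sub>M (p \<otimes> e \<otimes> (n \<oplus> \<one>)) \<otimes> modulus d i"
      by (rule arith.dvd_triv_right)
    ultimately show ?thesis using arith.dvd_add_right_iff[OF arith.dvd_mult2[OF dv]] by simp
  next
    case False
    then have "n \<prec> i" using assms(1) less_linear by blast
    then obtain c e where c: "i = n \<oplus> c" "d = c \<otimes> e" using ex assms(2) by blast
    have "(p \<otimes> modulus d n) \<otimes> (e \<otimes> (i \<oplus> \<one>)) = (p \<otimes> e \<otimes> (n \<oplus> \<one>)) \<otimes> modulus d i \<oplus> p \<otimes> d"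
      unfolding modulus_def c by (simp add: algebra_simps)
    moreover have "modulus d i dvd\<^sub>M (p \<otimes> modulus d n) \<otimes> (e \<otimes> (i \<oplus> \<one>))"
      by (rule arith.dvd_mult2[OF dv])
    ultimately show ?thesis using arith.dvd_add_right_iff[OF arith.dvd_triv_right] by simp
  qed
  then have "modulus d i dvd\<^sub>M (p \<otimes> d) \<otimes> (i \<oplus> \<one>)" by (rule arith.dvd_mult2)
  from arith.dvd_add_right_iff[OF this, of p]
  have "modulus d i dvd\<^sub>M (p \<otimes> d) \<otimes> (i \<oplus> \<one>) \<oplus> p \<longleftrightarrow> modulus d i dvd\<^sub>M p" .
  moreover have "(p \<otimes> d) \<otimes> (i \<oplus> \<one>) \<oplus> p = p \<otimes> modulus d i"
    unfolding modulus_def by (simp add: algebra_simps)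
  ultimately show ?thesis by simp
qed

text \<open>\<open>p\<close> is the product of the moduli of those \<open>i\<close> that satisfy
  \<open>R\<close>, built one factor at a time; coprimality prevents a new factor from bringing in
  other elements.\<close>

lemma finite_comprehension:
  assumes R: "bdef M 1 (\<lambda>e. R (e 0))"
  shows "\<exists>w. \<forall>x. x \<epsilon> w \<longleftrightarrow> x \<prec> m \<and> R x"
proof -
  obtain d where d: "\<zero> \<prec> d" "\<And>x. x \<prec> m \<oplus> \<one> \<Longrightarrow> \<zero> \<prec> x \<Longrightarrow> x dvd\<^sub>M d" using common_multiple by blast
  have "\<exists>p. \<forall>i. i \<prec> m \<longrightarrow> (modulus d i dvd\<^sub>M p \<longleftrightarrow> i \<prec> n \<and> R i)" for n
  proof (induction rule: sigma1_ind[of "\<lambda>n p. \<forall>i. i \<prec> m \<longrightarrow> (modulus d i dvd\<^sub>M p \<longleftrightarrow> i \<prec> n \<and> R i)"])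
    case 1
    show ?case unfolding modulus_def
      by (intro bdef_intros bdef_dvd bdef_rename1[OF R]; simp)
  next
    case 2
    \<comment> \<open>The empty product codes the empty set because \<open>d\<close> is positive, so
      that every modulus exceeds 1.\<close>
    have "\<not> modulus d i dvd\<^sub>M \<one>" for i
    proof
      assume "modulus d i dvd\<^sub>M \<one>"
      then obtain k where "\<one> = modulus d i \<otimes> k" by (elim arith.dvdE)
      moreover from this obtain j where "k = j \<oplus> \<one>"
        using zero_or_Suc[of k] by (auto simp: mul_0)
      ultimately have "modulus d i \<preceq> \<one>" unfolding le_iff_add by (metis mul_Suc Add_commute)
      moreover have "\<one> \<prec> modulus d i"
        unfolding modulus_def using arith.mult_pos_pos[OF zero_less_Suc d(1)] by simp
      ultimately show False using arith.not_le by blast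
    qed
    then show ?case by (intro exI[of _ \<one>]) (simp add: not_less_0)
  next
    case (3 n)
    then obtain p where p: "\<And>i. i \<prec> m \<Longrightarrow> modulus d i dvd\<^sub>M p \<longleftrightarrow> i \<prec> n \<and> R i" by blast
    show ?case
    proof (cases "n \<prec> m \<and> R n")
      case True
      have "modulus d i dvd\<^sub>M p \<otimes> modulus d n \<longleftrightarrow> i \<prec> n \<oplus> \<one> \<and> R i" if "i \<prec> m" for i
      proof (cases "i = n")
        case True
        then show ?thesis using \<open>n \<prec> m \<and> R n\<close> by (simp add: less_Suc)
      next
        case False
        then have "modulus d i dvd\<^sub>M p \<otimes> modulus d n \<longleftrightarrow> modulus d i dvd\<^sub>M p"
          using modulus_coprime[OF False that _ d(2)] True arith.dvd_mult2 by blast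
        then show ?thesis using p that False by (simp add: less_Suc)
      qed
      then show ?thesis by blast
    next
      case False
      then show ?thesis using p by (auto simp: less_Suc)
    qed
  qed
  then obtain p where "\<And>i. i \<prec> m \<Longrightarrow> modulus d i dvd\<^sub>M p \<longleftrightarrow> i \<prec> m \<and> R i" by blast
  then show ?thesis by (intro exI[of _ "pr (pr p d) m"]) (auto simp: elt_pr)
qed

lemma finite_comprehension2:
  assumes R: "bdef M 2 (\<lambda>e. R (e 0) (e 1))"
  shows "\<exists>w. \<forall>t i. pr t i \<epsilon> w \<longleftrightarrow> t \<prec> m \<and> i \<prec> n \<and> R t i"
proof -
  have "bdef M 1 (\<lambda>e. \<exists>t. t \<prec> m \<and> (\<exists>i. i \<prec> n \<and> (e 0 = pr t i \<and> R t i)))"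
    by (intro bdef_intros tdef_pr bdef_rename2[OF R]; simp)
  \<comment> \<open>By strict monotonicity of \<open>pr\<close>, the number \<open>pr m n\<close>
    exceeds all pairs in question.\<close>
  from finite_comprehension[OF this, of "pr m n"] obtain w where
    "\<And>x. x \<epsilon> w \<longleftrightarrow> x \<prec> pr m n \<and> (\<exists>t. t \<prec> m \<and> (\<exists>i. i \<prec> n \<and> (x = pr t i \<and> R t i)))" by blast
  then show ?thesis
    using pr_mono_strict by (intro exI[of _ w]) (auto simp: pr_inj)
qed


subsection \<open>Collection, pigeonhole principle and recursion\<close>

text \<open>Induction along an initial segment of the \<open>x\<close>: monotonicity lets one larger
  number replace the bound found so far and the next one. The bounded quantifier over
  \<open>x\<close> stays in the matrix, so the formula remains Sigma-0-2.\<close>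

lemma collection:
  assumes Q: "bdef M 3 (\<lambda>e. Q (e 0) (e 1) (e 2))"
    and mono: "\<And>x n n' y. Q x n y \<Longrightarrow> n \<prec> n' \<Longrightarrow> Q x n' y"
    and ex: "\<And>x. x \<prec> b \<Longrightarrow> \<exists>n. \<forall>y. Q x n y"
  shows "\<exists>n. \<forall>x y. x \<prec> b \<longrightarrow> Q x n y"
proof -
  have "\<exists>n. \<forall>y. \<forall>x. x \<prec> m \<longrightarrow> x \<prec> b \<longrightarrow> Q x n y" for m
  proof (rule sigma2_ind[of "\<lambda>m n y. \<forall>x. x \<prec> m \<longrightarrow> x \<prec> b \<longrightarrow> Q x n y"])
    fix m assume "\<exists>n. \<forall>y. \<forall>x. x \<prec> m \<longrightarrow> x \<prec> b \<longrightarrow> Q x n y"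
    then obtain n where n: "\<And>x y. x \<prec> m \<Longrightarrow> x \<prec> b \<Longrightarrow> Q x n y" by blast
    show "\<exists>n. \<forall>y. \<forall>x. x \<prec> m \<oplus> \<one> \<longrightarrow> x \<prec> b \<longrightarrow> Q x n y"
    proof (cases "m \<prec> b")
      case True
      then obtain n' where n': "\<And>y. Q m n' y" using ex by blast
      \<comment> \<open>\<open>mono\<close> asks for a strict increase, hence the added
        \<open>\<one>\<close>.\<close>
      define N where "N = n \<oplus> n' \<oplus> \<one>"
      have "n \<prec> N" "n' \<prec> N"
        unfolding N_def less_Suc le_iff_add using Add_commute by blast+
      then have "x \<prec> m \<oplus> \<one> \<Longrightarrow> x \<prec> b \<Longrightarrow> Q x N y" for x y
        using n n' mono unfolding less_Suc by blast
      then show ?thesis by blast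
    next
      case False
      then show ?thesis using n unfolding less_Suc by blast
    qed
  qed (use not_less_0 in \<open>blast | intro bdef_intros bdef_rename3[OF Q]; simp\<close>)+
  then show ?thesis by blast
qed

text \<open>The least number principle for Sigma-0-1 properties: without a least instance, Pi-0-1
  induction excludes all instances below any \<open>n\<close>.\<close>

lemma least_number:
  assumes Q: "bdef M 2 (\<lambda>e. Q (e 0) (e 1))" and ex: "Q n x"
  shows "\<exists>i. (\<exists>x. Q i x) \<and> (\<forall>j x. j \<prec> i \<longrightarrow> \<not> Q j x)"
proof (rule ccontr)
  assume neg: "\<not> ?thesis"
  have "\<forall>j. j \<prec> n \<oplus> \<one> \<longrightarrow> \<not> Q j y" for y
  proof (rule pi1_ind[of "\<lambda>n y. \<forall>j. j \<prec> n \<longrightarrow> \<not> Q j y"])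
    show "bdef M 2 (\<lambda>e. \<forall>j. j \<prec> e 0 \<longrightarrow> \<not> Q j (e 1))"
      by (intro bdef_intros bdef_rename2[OF Q]; simp)
  next
    fix n y assume "\<And>y. \<forall>j. j \<prec> n \<longrightarrow> \<not> Q j y"
    then show "\<forall>j. j \<prec> n \<oplus> \<one> \<longrightarrow> \<not> Q j y" using neg unfolding less_Suc by blast
  qed (use not_less_0 in blast)
  then show False using ex less_Suc by blast
qed

text \<open>Pi-0-1 induction on \<open>n\<close> for all codes \<open>w\<close> at once, since the
  step passes to a modified code. The coded relation may be multivalued.\<close>

lemma pigeonhole:
  assumes "\<And>t. t \<prec> n \<oplus> \<one> \<Longrightarrow> \<exists>a. a \<prec> n \<and> pr t a \<epsilon> w"
  shows "\<exists>t t' a. t \<prec> n \<oplus> \<one> \<and> t' \<prec> n \<oplus> \<one> \<and> a \<prec> n \<and> pr t a \<epsilon> w \<and> pr t' a \<epsilon> w \<and> t \<noteq> t'"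
proof -
  let ?P = "\<lambda>n w. (\<forall>t. t \<prec> n \<oplus> \<one> \<longrightarrow> (\<exists>a. a \<prec> n \<and> pr t a \<epsilon> w)) \<longrightarrow>
    (\<exists>t. t \<prec> n \<oplus> \<one> \<and> (\<exists>t'. t' \<prec> n \<oplus> \<one> \<and> (\<exists>a. a \<prec> n \<and> (pr t a \<epsilon> w \<and> pr t' a \<epsilon> w \<and> t \<noteq> t'))))"
  have "?P n w"
  proof (rule pi1_ind[of ?P])
    show "bdef M 2 (\<lambda>e. ?P (e 0) (e 1))"
      by (intro bdef_intros bdef_elt tdef_pr; simp)
    show "?P \<zero> w" for w using zero_less_Suc not_less_0 by blast
  next
    fix n w assume IH: "\<And>w. ?P n w"
    let ?n = "n \<oplus> \<one>"
    show "?P (n \<oplus> \<one>) w"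
    proof (rule impI, rule ccontr)
      assume tot: "\<forall>t. t \<prec> ?n \<oplus> \<one> \<longrightarrow> (\<exists>a. a \<prec> ?n \<and> pr t a \<epsilon> w)"
        and "\<not> (\<exists>t. t \<prec> ?n \<oplus> \<one> \<and> (\<exists>t'. t' \<prec> ?n \<oplus> \<one> \<and> (\<exists>a. a \<prec> ?n \<and>
          (pr t a \<epsilon> w \<and> pr t' a \<epsilon> w \<and> t \<noteq> t'))))"
      then have inj: "t = t'"
        if "t \<prec> ?n \<oplus> \<one>" "t' \<prec> ?n \<oplus> \<one>" "a \<prec> ?n" "pr t a \<epsilon> w" "pr t' a \<epsilon> w" for t t' a
        using that by blast
      have n: "n \<prec> ?n" "?n \<prec> ?n \<oplus> \<one>" unfolding less_Suc by simp_all
      have lift: "x \<prec> ?n \<Longrightarrow> x \<prec> ?n \<oplus> \<one>" "x \<prec> n \<Longrightarrow> x \<prec> ?n" for x unfolding less_Suc by simp_all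
      show False
      proof (cases "\<exists>t0. t0 \<prec> ?n \<oplus> \<one> \<and> pr t0 n \<epsilon> w")
        case False
        then have "\<exists>a. a \<prec> n \<and> pr t a \<epsilon> w" if "t \<prec> ?n" for t
          using tot lift(1)[OF that] less_Suc by metis
        then show False using IH[of w] inj lift by blast
      next
        case True
        then obtain t0 where t0: "t0 \<prec> ?n \<oplus> \<one>" "pr t0 n \<epsilon> w" by blast
        \<comment> \<open>The argument \<open>t0\<close> with the top value \<open>n\<close> takes
          over the values of the last argument \<open>?n\<close>, which leaves the domain; if
          \<open>t0\<close> is \<open>?n\<close>, this merely restricts the relation.\<close>
        have "bdef M 2 (\<lambda>e. (e 0 \<noteq> t0 \<and> pr (e 0) (e 1) \<epsilon> w) \<or> (e 0 = t0 \<and> pr ?n (e 1) \<epsilon> w))"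
          by (intro bdef_intros bdef_elt tdef_pr; simp)
        from finite_comprehension2[OF this, of ?n n] obtain w' where w': "\<And>t a. pr t a \<epsilon> w' \<longleftrightarrow>
            t \<prec> ?n \<and> a \<prec> n \<and> ((t \<noteq> t0 \<and> pr t a \<epsilon> w) \<or> (t = t0 \<and> pr ?n a \<epsilon> w))" by blast
        have val: "\<exists>a. a \<prec> n \<and> pr t a \<epsilon> w" if "t \<prec> ?n \<oplus> \<one>" "t \<noteq> t0" for t
          using tot[rule_format, OF that(1)] inj[OF that(1) t0(1) n(1) _ t0(2)] that(2) less_Suc by blast
        have "\<exists>a. a \<prec> n \<and> pr t a \<epsilon> w'" if "t \<prec> ?n" for t
        proof (cases "t = t0")
          case True
          then have "?n \<noteq> t0" using that less_irrefl by blast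
          then show ?thesis using val[OF n(2)] w' True that by blast
        next
          case False
          then show ?thesis using val[OF lift(1)[OF that]] w' that by blast
        qed
        then obtain t t' a where t: "t \<prec> ?n" "t' \<prec> ?n" "a \<prec> n" "pr t a \<epsilon> w'" "pr t' a \<epsilon> w'" "t \<noteq> t'"
          using IH[of w'] by blast
        have "x = ?n" if "x \<prec> ?n" "pr x a \<epsilon> w" "pr ?n a \<epsilon> w" for x
          using inj[OF lift(1)[OF that(1)] n(2) lift(2)[OF t(3)]] that by blast
        then show False
          using t w' inj[OF lift(1)[OF t(1)] lift(1)[OF t(2)] lift(2)[OF t(3)]] less_irrefl by metis
      qed
    qed
  qed
  then show ?thesis using assms by blast
qed

text \<open>Course-of-values recursion: \<open>?hist n w\<close> says that \<open>w\<close> obeys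
  the greedy rule below \<open>n\<close>. Such histories exist by Sigma-0-1 induction and agree with
  one another below \<open>n\<close>, so membership in \<open>I\<close> has both an existential and
  a universal definition.\<close>

lemma greedy_clique:
  assumes D: "D \<in> s_sets M" and G: "bdef M 2 (\<lambda>e. G (e 0) (e 1))"
  shows "\<exists>I\<in>s_sets M. \<forall>x. x \<in> I \<longleftrightarrow> x \<in> D \<and> (\<forall>y\<in>I. y \<prec> x \<longrightarrow> G y x)"
proof -
  let ?R = "\<lambda>w x. x \<in> D \<and> (\<forall>y. y \<prec> x \<longrightarrow> y \<epsilon> w \<longrightarrow> G y x)"
  let ?hist = "\<lambda>n w. \<forall>x. x \<prec> n \<longrightarrow> (x \<epsilon> w \<longleftrightarrow> ?R w x)"
  have hist: "\<exists>w. ?hist n w" for n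
  proof (rule sigma1_ind[of ?hist])
    show "bdef M 2 (\<lambda>e. ?hist (e 0) (e 1))"
      by (intro bdef_intros bdef_elt D bdef_rename2[OF G]; simp)
  next
    fix n assume "\<exists>w. ?hist n w"
    then obtain w where w: "?hist n w" by blast
    have "bdef M 1 (\<lambda>e. ?R w (e 0))"
      by (intro bdef_intros bdef_elt D bdef_rename2[OF G]; simp)
    from finite_comprehension[OF this, of "n \<oplus> \<one>"]
    obtain w' where w': "\<And>x. x \<epsilon> w' \<longleftrightarrow> x \<prec> n \<oplus> \<one> \<and> ?R w x" by blast
    then have eq: "y \<epsilon> w' \<longleftrightarrow> y \<epsilon> w" if "y \<prec> n" for y
      using w that unfolding less_Suc by blast
    \<comment> \<open>The rule at \<open>x\<close> consults only smaller elements, on which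
      \<open>w\<close> and \<open>w'\<close> agree.\<close>
    have "x \<epsilon> w' \<longleftrightarrow> ?R w' x" if "x \<prec> n \<oplus> \<one>" for x
    proof -
      have "y \<prec> n" if "y \<prec> x" for y
        using \<open>x \<prec> n \<oplus> \<one>\<close> that less_trans' unfolding less_Suc by blast
      then show ?thesis using w' eq that by blast
    qed
    then show "\<exists>w. ?hist (n \<oplus> \<one>) w" by blast
  qed (use not_less_0 in blast)
  have uniq: "x \<epsilon> w \<longleftrightarrow> x \<epsilon> w'" if h: "?hist n w" "?hist n w'" and x: "x \<prec> n" for n w w' x
  proof -
    have "\<forall>x. x \<prec> m \<longrightarrow> x \<prec> n \<longrightarrow> (x \<epsilon> w \<longleftrightarrow> x \<epsilon> w')" for m
    proof (induction m rule: bounded_ind)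
      case def
      show ?case by (intro bdef_intros bdef_elt; simp)
    next
      case (Suc m)
      then have "m \<prec> n \<Longrightarrow> ?R w m \<longleftrightarrow> ?R w' m" using less_trans' by blast
      then have "m \<prec> n \<Longrightarrow> m \<epsilon> w \<longleftrightarrow> m \<epsilon> w'" using h by blast
      with Suc show ?case unfolding less_Suc by blast
    qed (use not_less_0 in blast)
    then show ?thesis using x by blast
  qed
  \<comment> \<open>A history has to reach \<open>x \<oplus> \<one>\<close> in order to decide
    \<open>x\<close>.\<close>
  have "\<exists>I\<in>s_sets M. \<forall>x. x \<in> I \<longleftrightarrow> (\<exists>w. ?hist (x \<oplus> \<one>) w \<and> x \<epsilon> w)"
  proof (rule delta1_comprehension[OF ca, of _ "\<lambda>x w. ?hist (x \<oplus> \<one>) w \<longrightarrow> x \<epsilon> w"])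
    show "bdef M 2 (\<lambda>e. ?hist (e 1 \<oplus> \<one>) (e 0) \<and> e 1 \<epsilon> e 0)"
      by (intro bdef_intros bdef_elt D bdef_rename2[OF G]; simp)
    show "bdef M 2 (\<lambda>e. ?hist (e 1 \<oplus> \<one>) (e 0) \<longrightarrow> e 1 \<epsilon> e 0)"
      by (intro bdef_intros bdef_elt D bdef_rename2[OF G]; simp)
    show "(\<exists>w. ?hist (x \<oplus> \<one>) w \<and> x \<epsilon> w) \<longleftrightarrow> (\<forall>w. ?hist (x \<oplus> \<one>) w \<longrightarrow> x \<epsilon> w)" for x
    proof -
      have "x \<prec> x \<oplus> \<one>" by (simp add: less_Suc)
      then show ?thesis using hist[of "x \<oplus> \<one>"] uniq[of "x \<oplus> \<one>" _ _ x] by blast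
    qed
  qed
  then obtain I where I: "I \<in> s_sets M" "\<And>x. x \<in> I \<longleftrightarrow> (\<exists>w. ?hist (x \<oplus> \<one>) w \<and> x \<epsilon> w)" by blast
  have "x \<in> I \<longleftrightarrow> x \<in> D \<and> (\<forall>y\<in>I. y \<prec> x \<longrightarrow> G y x)" for x
  proof -
    obtain w where w: "?hist (x \<oplus> \<one>) w" using hist by blast
    have eq: "y \<in> I \<longleftrightarrow> y \<epsilon> w" if "y \<preceq> x" for y
    proof -
      have "z \<prec> y \<oplus> \<one> \<Longrightarrow> z \<prec> x \<oplus> \<one>" for z using that less_trans' unfolding less_Suc by blast
      then have "?hist (y \<oplus> \<one>) w" using w by blast
      moreover have "y \<prec> y \<oplus> \<one>" by (simp add: less_Suc)
      ultimately show ?thesis using I(2) uniq[of "y \<oplus> \<one>" _ w y] by blast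
    qed
    have "x \<epsilon> w \<longleftrightarrow> ?R w x" using w less_Suc by blast
    then show ?thesis using eq by blast
  qed
  with I(1) show ?thesis by blast
qed

end

section \<open>Additive colourings\<close>

locale additive_colouring = ind2_model M for M :: "'m l2struct" +
  fixes S T C :: "'m set" and k :: 'm
  assumes sg: "finite_semigroup M S T" and colouring: "colouring M S C"
    and additive: "additive M S T C" and bound: "\<And>a. a \<in> S \<Longrightarrow> a \<prec> k"
begin

abbreviation col where "col \<equiv> coded3 M C"

lemma C_set: "C \<in> s_sets M"
  using colouring unfolding colouring_def by blast

lemma col_ex: "i \<prec> j \<Longrightarrow> \<exists>a\<in>S. col i j a"
  and col_unique: "i \<prec> j \<Longrightarrow> col i j a \<Longrightarrow> col i j b \<Longrightarrow> a = b"
  using colouring unfolding colouring_def by blast+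

lemma col_in: "i \<prec> j \<Longrightarrow> col i j a \<Longrightarrow> a \<in> S"
  using col_ex col_unique by blast

text \<open>The bound \<open>k\<close> on the common colour makes merging at a given stage a bounded
  condition. Colours of pairs not in increasing order are unconstrained, hence the side conditions
  such as \<open>i \<prec> K\<close> in the lemmas.\<close>

definition merged where "merged i j K \<longleftrightarrow> (\<exists>a. a \<prec> k \<and> (col i K a \<and> col j K a))"

lemma bdef_merged:
  "tdef M n f \<Longrightarrow> tdef M n g \<Longrightarrow> tdef M n h \<Longrightarrow> bdef M n (\<lambda>e. merged (f e) (g e) (h e))"
  unfolding merged_def by (intro bdef_intros bdef_coded3 tdef_shift C_set) auto

lemma merged_refl: "i \<prec> K \<Longrightarrow> merged i i K"
  unfolding merged_def using col_ex bound by blast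

lemma merged_sym: "merged i j K \<Longrightarrow> merged j i K"
  unfolding merged_def by blast

lemma merged_trans: "merged i j K \<Longrightarrow> merged j l K \<Longrightarrow> j \<prec> K \<Longrightarrow> merged i l K"
  unfolding merged_def using col_unique by blast

lemma merged_col: "merged i j K \<Longrightarrow> i \<prec> K \<Longrightarrow> j \<prec> K \<Longrightarrow> col i K a \<longleftrightarrow> col j K a"
  unfolding merged_def using col_unique by blast

text \<open>The colours of \<open>i\<close> and \<open>j\<close> at \<open>K'\<close> are both the
  product of their common colour at \<open>K\<close> with the colour of \<open>K\<close> and
  \<open>K'\<close>, and products in \<open>S\<close> are unique.\<close>

lemma merged_later:
  assumes "merged i j K" "i \<prec> K" "j \<prec> K" "K \<preceq> K'" shows "merged i j K'"
proof (cases "K = K'")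
  case False
  then have K: "K \<prec> K'" using assms(4) by blast
  obtain a where a: "col i K a" "col j K a" using assms(1) unfolding merged_def by blast
  obtain c where c: "c \<in> S" "col K K' c" using col_ex[OF K] by blast
  have iK: "i \<prec> K'" and jK: "j \<prec> K'" using assms(2,3) K less_trans' by blast+
  obtain x where x: "x \<in> S" "col i K' x" using col_ex[OF iK] by blast
  obtain y where y: "y \<in> S" "col j K' y" using col_ex[OF jK] by blast
  have "coded3 M T a c x" "coded3 M T a c y"
    using additive assms(2,3) K a c x y unfolding additive_def by blast+
  moreover have "a \<in> S" using col_in a(1) assms(2) by blast
  ultimately have "x = y"
    using sg c(1) x(1) y(1) unfolding finite_semigroup_def by blast
  then show ?thesis using x y bound unfolding merged_def by blast
qed (use assms in simp)

text \<open>Otherwise unboundedly many numbers would have merged with no smaller number. By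
  \<open>\<Sigma>\<^sup>0\<^sub>2\<close> induction there would be coded sets of \<open>k + 1\<close> of them, and any large enough
  stage would map such a set injectively into the colours below \<open>k\<close>.\<close>
lemma finitely_many_classes:
  "\<exists>b. \<forall>j. \<exists>i K. i \<prec> b \<and> i \<preceq> j \<and> j \<prec> K \<and> merged i j K"
proof -
  \<comment> \<open>Holding for all \<open>y\<close>, this makes \<open>i\<close> the least element
    of its class.\<close>
  define new where "new i y \<longleftrightarrow> (\<forall>i'. i' \<prec> i \<longrightarrow> i \<prec> y \<longrightarrow> \<not> merged i' i y)" for i y
  have bdef_new: "bdef M 2 (\<lambda>e. new (e 0) (e 1))"
    unfolding new_def by (intro bdef_intros bdef_merged; simp)
  \<comment> \<open>The representative is the least number that ever merges with
    \<open>j\<close>.\<close>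
  have rep: "\<exists>i K. (\<forall>y. new i y) \<and> i \<preceq> j \<and> j \<prec> K \<and> merged i j K" for j
  proof -
    have "bdef M 2 (\<lambda>e. j \<prec> e 1 \<and> merged (e 0) j (e 1))"
      by (intro bdef_intros bdef_merged; simp)
    moreover have "j \<prec> j \<oplus> \<one>" by (simp add: less_Suc)
    then have "j \<prec> j \<oplus> \<one> \<and> merged j j (j \<oplus> \<one>)" using merged_refl by blast
    ultimately obtain i K where i: "j \<prec> K" "merged i j K"
        and min: "\<And>i' y. i' \<prec> i \<Longrightarrow> \<not> (j \<prec> y \<and> merged i' j y)"
      using least_number[of "\<lambda>i K. j \<prec> K \<and> merged i j K" j "j \<oplus> \<one>"] by blast
    have ij: "i \<preceq> j"
      using min[of j] \<open>j \<prec> j \<oplus> \<one> \<and> merged j j (j \<oplus> \<one>)\<close> less_linear by blast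
    then have iK: "i \<prec> K" using i(1) less_trans' by blast
    have "new i y" for y
      unfolding new_def
    proof (intro allI impI notI)
      fix i' assume i': "i' \<prec> i" "i \<prec> y" "merged i' i y"
      \<comment> \<open>At a stage past both, the two mergings compose, contradicting the choice of
        \<open>i\<close>.\<close>
      define Y where "Y = y \<oplus> K"
      have Y: "y \<preceq> Y" "K \<preceq> Y" unfolding Y_def le_iff_add using Add_commute by blast+
      have "merged i' i Y" using merged_later i' less_trans' Y(1) by blast
      moreover have "merged i j Y" using merged_later i iK Y(2) by blast
      moreover have "j \<prec> Y" "i \<prec> Y" using i(1) iK Y(2) less_trans' by blast+
      ultimately show False using merged_trans min i'(1) by blast
    qed
    then show ?thesis using i ij by blast
  qed
  have "\<exists>b. \<forall>i. (\<forall>y. new i y) \<longrightarrow> i \<prec> b"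
  proof (rule ccontr)
    assume "\<not> ?thesis"
    then have unb: "\<exists>i. (\<forall>y. new i y) \<and> \<not> i \<prec> b" for b by blast
    \<comment> \<open>Positions below \<open>c\<close> carry new numbers, distinct ones at distinct
      positions. Bounding \<open>i\<close> by the code leaves \<open>w\<close> and \<open>y\<close>
      as the only unbounded variables.\<close>
    let ?P = "\<lambda>c w y. (\<forall>t. t \<prec> c \<longrightarrow> (\<exists>i. i \<prec> w \<and> pr t i \<epsilon> w)) \<and>
      (\<forall>t. t \<prec> c \<longrightarrow> (\<forall>i. i \<prec> w \<longrightarrow> pr t i \<epsilon> w \<longrightarrow> new i y)) \<and>
      (\<forall>t. t \<prec> c \<longrightarrow> (\<forall>t'. t' \<prec> c \<longrightarrow> (\<forall>i. i \<prec> w \<longrightarrow> pr t i \<epsilon> w \<longrightarrow> pr t' i \<epsilon> w \<longrightarrow> t = t')))"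
    have "\<exists>w. \<forall>y. ?P c w y" for c
    proof (rule sigma2_ind[of ?P])
      show "bdef M 3 (\<lambda>e. ?P (e 2) (e 1) (e 0))"
        by (intro bdef_intros bdef_elt tdef_pr bdef_rename2[OF bdef_new]; simp)
    next
      fix c assume "\<exists>w. \<forall>y. ?P c w y"
      then obtain w where "\<And>y. ?P c w y" by blast
      then have w: "\<And>t. t \<prec> c \<Longrightarrow> \<exists>i. i \<prec> w \<and> pr t i \<epsilon> w"
          "\<And>t i y. t \<prec> c \<Longrightarrow> i \<prec> w \<Longrightarrow> pr t i \<epsilon> w \<Longrightarrow> new i y"
          "\<And>t t' i. t \<prec> c \<Longrightarrow> t' \<prec> c \<Longrightarrow> i \<prec> w \<Longrightarrow> pr t i \<epsilon> w \<Longrightarrow> pr t' i \<epsilon> w \<Longrightarrow> t = t'"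
        by blast+
      \<comment> \<open>A new number not below the code \<open>w\<close> differs from all numbers
        recorded in \<open>w\<close>.\<close>
      obtain n where n: "\<And>y. new n y" "\<not> n \<prec> w" using unb by blast
      have "bdef M 2 (\<lambda>e. (e 0 \<prec> c \<and> (e 1 \<prec> w \<and> pr (e 0) (e 1) \<epsilon> w)) \<or> (e 0 = c \<and> e 1 = n))"
        by (intro bdef_intros bdef_elt tdef_pr; simp)
      from finite_comprehension2[OF this, of "c \<oplus> \<one>" "n \<oplus> \<one>"] obtain w' where w':
        "\<And>t i. pr t i \<epsilon> w' \<longleftrightarrow> t \<prec> c \<oplus> \<one> \<and> i \<prec> n \<oplus> \<one> \<and>
          ((t \<prec> c \<and> (i \<prec> w \<and> pr t i \<epsilon> w)) \<or> (t = c \<and> i = n))" by blast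
      have wn: "i \<prec> n \<oplus> \<one>" "i \<noteq> n" if "i \<prec> w" for i
        using that n(2) less_linear[of n w] less_trans' unfolding less_Suc by blast+
      have w'1: "pr t i \<epsilon> w' \<longleftrightarrow> (t \<prec> c \<and> i \<prec> w \<and> pr t i \<epsilon> w) \<or> (t = c \<and> i = n)" for t i
        unfolding w' using wn less_Suc by blast
      have bd: "i \<prec> w'" if "pr t i \<epsilon> w'" for t i
        using elt_less[OF that] le_pr(2)[of i t] less_trans' by metis
      have "\<exists>i. i \<prec> w' \<and> pr t i \<epsilon> w'" if "t \<prec> c \<oplus> \<one>" for t
      proof (cases "t = c")
        case True
        then show ?thesis using bd w'1 by blast
      next
        case False
        then have "t \<prec> c" using that unfolding less_Suc by blast
        then obtain i where "i \<prec> w" "pr t i \<epsilon> w" using w(1) by blast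
        then show ?thesis using bd w'1 \<open>t \<prec> c\<close> by blast
      qed
      moreover have "new i y" if "pr t i \<epsilon> w'" for t i y
        using that w(2) n(1) unfolding w'1 by blast
      moreover have "t = t'" if "pr t i \<epsilon> w'" "pr t' i \<epsilon> w'" for t t' i
        using that w(3) wn(2) unfolding w'1 by blast
      ultimately show "\<exists>w. \<forall>y. ?P (c \<oplus> \<one>) w y" by blast
    qed (use not_less_0 in blast)
    then obtain w where "\<And>y. ?P (k \<oplus> \<one>) w y" by blast
    then have w: "\<And>t. t \<prec> k \<oplus> \<one> \<Longrightarrow> \<exists>i. i \<prec> w \<and> pr t i \<epsilon> w"
        "\<And>t i y. t \<prec> k \<oplus> \<one> \<Longrightarrow> i \<prec> w \<Longrightarrow> pr t i \<epsilon> w \<Longrightarrow> new i y"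
        "\<And>t t' i. t \<prec> k \<oplus> \<one> \<Longrightarrow> t' \<prec> k \<oplus> \<one> \<Longrightarrow> i \<prec> w \<Longrightarrow> pr t i \<epsilon> w \<Longrightarrow> pr t' i \<epsilon> w
          \<Longrightarrow> t = t'"
      by blast+
    \<comment> \<open>The code \<open>w\<close> itself serves as the late stage, as it exceeds the
      numbers it records; \<open>v\<close> relates positions to colours at that stage.\<close>
    have "bdef M 2 (\<lambda>e. \<exists>i. i \<prec> w \<and> (pr (e 0) i \<epsilon> w \<and> col i w (e 1)))"
      by (intro bdef_intros bdef_elt tdef_pr bdef_coded3 C_set; simp)
    from finite_comprehension2[OF this, of "k \<oplus> \<one>" k] obtain v where v: "\<And>t a. pr t a \<epsilon> v \<longleftrightarrow>
        t \<prec> k \<oplus> \<one> \<and> a \<prec> k \<and> (\<exists>i. i \<prec> w \<and> (pr t i \<epsilon> w \<and> col i w a))" by blast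
    have "\<exists>a. a \<prec> k \<and> pr t a \<epsilon> v" if "t \<prec> k \<oplus> \<one>" for t
    proof -
      obtain i where i: "i \<prec> w" "pr t i \<epsilon> w" using w(1) \<open>t \<prec> k \<oplus> \<one>\<close> by blast
      obtain a where "a \<in> S" "col i w a" using col_ex[OF i(1)] by blast
      then show ?thesis using v i bound \<open>t \<prec> k \<oplus> \<one>\<close> by blast
    qed
    from pigeonhole[OF this] obtain t t' a where t: "t \<prec> k \<oplus> \<one>" "t' \<prec> k \<oplus> \<one>" "a \<prec> k"
        "pr t a \<epsilon> v" "pr t' a \<epsilon> v" "t \<noteq> t'" by blast
    obtain i i' where i: "i \<prec> w" "pr t i \<epsilon> w" "col i w a" and i': "i' \<prec> w" "pr t' i' \<epsilon> w" "col i' w a"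
      using t(4,5) unfolding v by blast
    have m: "merged i i' w" "merged i' i w" using i(3) i'(3) t(3) unfolding merged_def by blast+
    have "new i w" "new i' w" using w(2) t(1,2) i i' by blast+
    \<comment> \<open>Otherwise the larger of the two would have merged with a smaller
      number.\<close>
    then have "i = i'" unfolding new_def using m i(1) i'(1) less_linear by blast
    then show False using w(3) t(1,2,6) i i'(2) by blast
  qed
  then show ?thesis using rep by blast
qed

text \<open>If every pair of a representative and a colour died out eventually, a single
  \<open>n\<close> would serve for all representatives below \<open>b\<close> and colours below
  \<open>k\<close>, and a number beyond it would have no representative and colour left.\<close>

lemma recurrent_colour:
  "\<exists>i a. a \<in> S \<and> (\<forall>n. \<exists>j K. n \<prec> j \<and> i \<prec> j \<and> j \<prec> K \<and> merged i j K \<and> col i j a)"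
proof (rule ccontr)
  assume neg: "\<not> ?thesis"
  obtain b where b: "\<And>j. \<exists>i K. i \<prec> b \<and> i \<preceq> j \<and> j \<prec> K \<and> merged i j K"
    using finitely_many_classes by blast
  \<comment> \<open>The single variable \<open>y\<close> is both the merging stage and the bound on
    \<open>j\<close>, which leaves one universal quantifier.\<close>
  define Q where "Q i a n y \<longleftrightarrow>
    (\<forall>j. j \<prec> y \<longrightarrow> n \<prec> j \<longrightarrow> i \<prec> j \<longrightarrow> merged i j y \<longrightarrow> \<not> col i j a)" for i a n y
  have mono: "Q i a n' y" if "Q i a n y" "n \<prec> n'" for i a n n' y
    using that less_trans' unfolding Q_def by blast
  \<comment> \<open>Collection over the colours for fixed \<open>i\<close>; collection over the
    representatives follows.\<close>
  have "\<exists>n. \<forall>a y. a \<prec> k \<longrightarrow> Q i a n y" for i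
  proof (rule collection)
    show "bdef M 3 (\<lambda>e. Q i (e 0) (e 1) (e 2))"
      unfolding Q_def by (intro bdef_intros bdef_merged bdef_coded3 C_set; simp)
    show "\<exists>n. \<forall>y. Q i a n y" for a
    proof (cases "a \<in> S")
      case True
      then show ?thesis using neg unfolding Q_def by blast
    next
      case False
      then show ?thesis using col_in unfolding Q_def by blast
    qed
  qed (use mono in blast)
  then have "\<exists>n. \<forall>y. \<forall>a. a \<prec> k \<longrightarrow> Q i a n y" for i by blast
  then have "\<exists>n. \<forall>i y. i \<prec> b \<longrightarrow> (\<forall>a. a \<prec> k \<longrightarrow> Q i a n y)"
  proof (intro collection[of "\<lambda>i n y. \<forall>a. a \<prec> k \<longrightarrow> Q i a n y"])
    show "bdef M 3 (\<lambda>e. \<forall>a. a \<prec> k \<longrightarrow> Q (e 0) a (e 1) (e 2))"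
      unfolding Q_def by (intro bdef_intros bdef_merged bdef_coded3 C_set; simp)
  qed (use mono in blast)+
  then obtain n where n: "\<And>i a y. i \<prec> b \<Longrightarrow> a \<prec> k \<Longrightarrow> Q i a n y" by blast
  \<comment> \<open>Exceeding \<open>b\<close> puts the representative of \<open>j\<close> strictly
    below \<open>j\<close>, so that the two have a colour.\<close>
  define j where "j = n \<oplus> b \<oplus> \<one>"
  have j: "n \<prec> j" "b \<prec> j"
    unfolding j_def less_Suc le_iff_add using Add_commute by blast+
  obtain i K where i: "i \<prec> b" "j \<prec> K" "merged i j K" using b by blast
  have ij: "i \<prec> j" using i(1) j(2) less_trans' by blast
  obtain a where "a \<in> S" "col i j a" using col_ex[OF ij] by blast
  then show False using n[OF i(1) bound] i j ij unfolding Q_def by blast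
qed

text \<open>The universal definition \<open>?Q\<close>: every representative below \<open>b\<close>
  that ever merges with \<open>j\<close> has merged with \<open>i0\<close> by the fixed stage
  \<open>K0\<close>. Since \<open>j\<close> does have such a representative, this forces
  \<open>j\<close> to merge with \<open>i0\<close>.\<close>

lemma class_set:
  "\<exists>D\<in>s_sets M. \<forall>j. j \<in> D \<longleftrightarrow> (\<exists>K. i0 \<prec> j \<and> j \<prec> K \<and> merged i0 j K \<and> col i0 j a)"
proof -
  obtain b where b: "\<And>j. \<exists>i K. i \<prec> b \<and> i \<preceq> j \<and> j \<prec> K \<and> merged i j K"
    using finitely_many_classes by blast
  define m where "m i K \<longleftrightarrow> i \<prec> K \<and> i0 \<prec> K \<and> merged i0 i K" for i K
  have mono: "m i K'" if "m i K" "K \<prec> K'" for i K K'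
    using that merged_later less_trans' unfolding m_def by blast
  have "\<exists>K. \<forall>i y. i \<prec> b \<longrightarrow> m i y \<longrightarrow> m i K"
  proof (rule collection)
    show "bdef M 3 (\<lambda>e. m (e 0) (e 2) \<longrightarrow> m (e 0) (e 1))"
      unfolding m_def by (intro bdef_intros bdef_merged; simp)
    \<comment> \<open>Either \<open>m i\<close> holds at some stage, which can be taken for
      \<open>K\<close>, or the premise always fails.\<close>
    show "\<exists>K. \<forall>y. m i y \<longrightarrow> m i K" for i by blast
  qed (use mono in blast)
  then obtain K0 where K0: "\<And>i y. i \<prec> b \<Longrightarrow> m i y \<Longrightarrow> m i K0" by blast
  let ?P = "\<lambda>j x. i0 \<prec> j \<and> j \<prec> x \<and> merged i0 j x \<and> col i0 j a"
  let ?Q = "\<lambda>j x. i0 \<prec> j \<and> col i0 j a \<and>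
    (\<forall>i. i \<prec> b \<longrightarrow> j \<prec> x \<longrightarrow> i \<prec> x \<longrightarrow> merged i j x \<longrightarrow> m i K0)"
  show ?thesis
  proof (rule delta1_comprehension[OF ca, of ?P ?Q])
    show "bdef M 2 (\<lambda>e. ?P (e 1) (e 0))"
      by (intro bdef_intros bdef_merged bdef_coded3 C_set; simp)
    show "bdef M 2 (\<lambda>e. ?Q (e 1) (e 0))"
      unfolding m_def by (intro bdef_intros bdef_merged bdef_coded3 C_set; simp)
  next
    fix j
    show "(\<exists>x. ?P j x) \<longleftrightarrow> (\<forall>x. ?Q j x)"
    proof
      assume "\<exists>x. ?P j x"
      then obtain x where x: "i0 \<prec> j" "j \<prec> x" "merged i0 j x" "col i0 j a" by blast
      have "m i K0" if i: "i \<prec> b" "j \<prec> y" "i \<prec> y" "merged i j y" for i y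
      proof -
        define Y where "Y = y \<oplus> x"
        have Y: "y \<preceq> Y" "x \<preceq> Y" unfolding Y_def le_iff_add using Add_commute by blast+
        have "i0 \<prec> x" using x less_trans' by blast
        then have "merged i0 j Y" using merged_later x Y by blast
        moreover have "merged j i Y" using merged_later merged_sym i Y by blast
        moreover have "j \<prec> Y" "i \<prec> Y" using i Y less_trans' by blast+
        ultimately have "m i Y" unfolding m_def using merged_trans x(1) less_trans' by blast
        then show ?thesis using K0 i(1) by blast
      qed
      then show "\<forall>x. ?Q j x" using x by blast
    next
      assume Q: "\<forall>x. ?Q j x"
      obtain i K where i: "i \<prec> b" "i \<preceq> j" "j \<prec> K" "merged i j K" using b by blast
      have iK: "i \<prec> K" using i less_trans' by blast
      then have m: "m i K0" using Q i by blast
      define Y where "Y = K0 \<oplus> K"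
      have Y: "K0 \<preceq> Y" "K \<preceq> Y" unfolding Y_def le_iff_add using Add_commute by blast+
      have "merged i0 i Y" using merged_later m Y unfolding m_def by blast
      moreover have "merged i j Y" using merged_later i iK Y by blast
      moreover have "i \<prec> Y" "j \<prec> Y" using i iK Y less_trans' by blast+
      ultimately have "merged i0 j Y" using merged_trans by blast
      then show "\<exists>x. ?P j x" using Q \<open>j \<prec> Y\<close> by blast
    qed
  qed
qed

lemma homogeneous_set:
  "\<exists>I\<in>s_sets M. \<exists>a\<in>S. infinite_in M I \<and> (\<forall>i\<in>I. \<forall>j\<in>I. i \<prec> j \<longrightarrow> col i j a)"
proof -
  obtain i0 a where a: "a \<in> S" and
      inf: "\<And>n. \<exists>j K. n \<prec> j \<and> i0 \<prec> j \<and> j \<prec> K \<and> merged i0 j K \<and> col i0 j a"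
    using recurrent_colour by blast
  obtain D where D: "D \<in> s_sets M"
      "\<And>j. j \<in> D \<longleftrightarrow> (\<exists>K. i0 \<prec> j \<and> j \<prec> K \<and> merged i0 j K \<and> col i0 j a)"
    using class_set by blast
  have "bdef M 2 (\<lambda>e. col (e 0) (e 1) a)" by (intro bdef_intros bdef_coded3 C_set; simp)
  from greedy_clique[OF D(1) this] obtain I where I: "I \<in> s_sets M"
    "\<And>x. x \<in> I \<longleftrightarrow> x \<in> D \<and> (\<forall>y\<in>I. y \<prec> x \<longrightarrow> col y x a)" by blast
  have "\<exists>x\<in>I. n \<prec> x" for n
  proof (rule ccontr)
    assume neg: "\<not> (\<exists>x\<in>I. n \<prec> x)"
    \<comment> \<open>Collected over all elements of \<open>D\<close> up to \<open>n\<close>, which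
      include those of \<open>I\<close>; \<open>z\<close> is a dummy for the inner universal
      variable of \<open>collection\<close>.\<close>
    have "\<exists>K. \<forall>y (z::'m). y \<prec> n \<oplus> \<one> \<longrightarrow> (y \<in> D \<longrightarrow> i0 \<prec> y \<and> y \<prec> K \<and> merged i0 y K)"
    proof (rule collection[of "\<lambda>y K z. y \<in> D \<longrightarrow> i0 \<prec> y \<and> y \<prec> K \<and> merged i0 y K"])
      show "bdef M 3 (\<lambda>e. e 0 \<in> D \<longrightarrow> i0 \<prec> e 0 \<and> e 0 \<prec> e 1 \<and> merged i0 (e 0) (e 1))"
        by (intro bdef_intros bdef_merged D(1); simp)
      show "y \<in> D \<longrightarrow> i0 \<prec> y \<and> y \<prec> K' \<and> merged i0 y K'"
        if "y \<in> D \<longrightarrow> i0 \<prec> y \<and> y \<prec> K \<and> merged i0 y K" "K \<prec> K'" for y K K'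
        using that merged_later less_trans' by blast
    qed (use D(2) in blast)
    then obtain K where K: "\<And>y. y \<preceq> n \<Longrightarrow> y \<in> D \<Longrightarrow> i0 \<prec> y \<and> y \<prec> K \<and> merged i0 y K"
      unfolding less_Suc by blast
    \<comment> \<open>Beyond \<open>n\<close> to contradict the bound on \<open>I\<close>, and
      beyond \<open>K\<close> so that all members of \<open>I\<close> have merged with
      \<open>i0\<close> by stage \<open>x\<close>.\<close>
    obtain x where x: "n \<oplus> K \<prec> x" "x \<in> D" "i0 \<prec> x" "col i0 x a" using inf D(2) by blast
    have nx: "n \<prec> x" and Kx: "K \<prec> x"
      using x(1) arith.le_less_trans le_iff_add Add_commute by metis+
    have "col y x a" if "y \<in> I" for y
    proof -
      have "y \<preceq> n" using neg that less_linear by blast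
      moreover have "y \<in> D" using I(2) that by blast
      ultimately have y: "i0 \<prec> y" "y \<prec> K" "merged i0 y K" using K by blast+
      then have "merged i0 y x" using merged_later Kx less_trans' by blast
      moreover have "y \<prec> x" using y(2) Kx less_trans' by blast
      ultimately show ?thesis using merged_col x(3,4) by blast
    qed
    then have "x \<in> I" using I(2) x(2) by blast
    then show False using neg nx by blast
  qed
  then have "infinite_in M I" unfolding infinite_in_def by blast
  then show ?thesis using I a by blast
qed

end

theorem mainTheorem3:
  fixes M :: "'m l2struct"
  assumes "model_RCA0 M"
    and "Sigma02_IND M"
  shows "ART M"
  unfolding ART_def
proof (intro allI impI)
  fix S T C assume *: "finite_semigroup M S T" "colouring M S C" "additive M S T C"
  from *(1) have S: "S \<in> s_sets M" and "\<exists>k. \<forall>a\<in>S. s_less M a k"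
    unfolding finite_semigroup_def by simp_all
  then obtain k where k: "\<And>a. a \<in> S \<Longrightarrow> s_less M a k" by blast
  \<comment> \<open>\<open>S\<close> itself witnesses that the family of sets is nonempty.\<close>
  interpret additive_colouring M S T C k
    by unfold_locales (use assms * k S in \<open>auto simp: model_RCA0_def\<close>)
  show "\<exists>I\<in>s_sets M. \<exists>a\<in>S. infinite_in M I \<and>
      (\<forall>i\<in>I. \<forall>j\<in>I. s_less M i j \<longrightarrow> coded3 M C i j a)"
    by (rule homogeneous_set)
qed

end
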